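(* For every $n = 2+6\ell$ with $\ell$ a positive integer, there exists a non-homotopic $2$-colorable $1$-plane drawing of a graph on $n$ vertices with $\tfrac{8}{3}(n-2)$ crossings and $4(n-2)$ edges.
   Context: Drawings are in the plane: vertices are represented by points and edges by simple Jordan curves joining their endpoints. Edges cross only in internal points, do not share infinitely many points, do not touch, do not self-intersect, no more than two edges cross in a common point, and adjacent edges do not cross. Graphs may have parallel edges but no loops. A drawing is non-homotopic if every region whose boundary forms a lens, i.e. is formed by (parts of) exactly two edges, contains a vertex or a crossing in its interior. A drawing $\Gamma$ of a graph $G$ is $t$-colorable $k$-plane if there is a (not necessarily proper) edge-coloring $\varphi\colon E(G)\to\{1,\dots,t\}$ such that each edge is crossed in $\Gamma$ by at most $k$ edges of each of the $t$ colors. *)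

theory Defs
  imports "HOL-Analysis.Analysis"
begin

record ('v, 'e) multigraph =
  verts :: "'v set"
  edges :: "'e set"
  ends :: "'e \<Rightarrow> 'v set"

text \<open>Finite undirected graphs. Parallel edges are distinct edges with the same two-element set
  of ends; the cardinality condition excludes loops.\<close>

definition wf_multigraph :: "('v, 'e) multigraph \<Rightarrow> bool" where
  "wf_multigraph G \<longleftrightarrow> finite (verts G) \<and> finite (edges G) \<and>
     (\<forall>e\<in>edges G. ends G e \<subseteq> verts G \<and> card (ends G e) = 2)"

definition arc_interior :: "(real \<Rightarrow> complex) \<Rightarrow> complex set" where
  "arc_interior g = path_image g - {pathstart g, pathfinish g}"

text \<open>Two curves cross at \<open>p\<close>, as opposed to touching there, if some homeomorphism of a
  neighbourhood of \<open>p\<close> onto the unit disc takes them to the two coordinate axes.\<close>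

definition cross_at :: "complex \<Rightarrow> (real \<Rightarrow> complex) \<Rightarrow> (real \<Rightarrow> complex) \<Rightarrow> bool" where
  "cross_at p g1 g2 \<longleftrightarrow>
     (\<exists>U h k. open U \<and> p \<in> U \<and> homeomorphism U (ball 0 1) h k \<and> h p = 0 \<and>
        h ` (U \<inter> path_image g1) = {z \<in> ball 0 1. Im z = 0} \<and>
        h ` (U \<inter> path_image g2) = {z \<in> ball 0 1. Re z = 0})"

text \<open>A drawing places the vertex \<open>v\<close> at \<open>pos v\<close> and the edge \<open>e\<close> along the curve \<open>\<gamma> e\<close>,
  whose orientation is irrelevant. Parallel edges count as adjacent.\<close>

definition is_drawing ::
  "('v, 'e) multigraph \<Rightarrow> ('v \<Rightarrow> complex) \<Rightarrow> ('e \<Rightarrow> real \<Rightarrow> complex) \<Rightarrow> bool" where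
  "is_drawing G pos \<gamma> \<longleftrightarrow>
     inj_on pos (verts G) \<and>
     (\<forall>e\<in>edges G. arc (\<gamma> e) \<and> {pathstart (\<gamma> e), pathfinish (\<gamma> e)} = pos ` ends G e) \<and>
     (\<forall>e\<in>edges G. arc_interior (\<gamma> e) \<inter> pos ` verts G = {}) \<and>
     (\<forall>e\<in>edges G. \<forall>f\<in>edges G. e \<noteq> f \<longrightarrow>
        finite (path_image (\<gamma> e) \<inter> path_image (\<gamma> f)) \<and>
        (\<forall>p \<in> arc_interior (\<gamma> e) \<inter> arc_interior (\<gamma> f). cross_at p (\<gamma> e) (\<gamma> f)) \<and>
        (ends G e \<inter> ends G f \<noteq> {} \<longrightarrow> arc_interior (\<gamma> e) \<inter> arc_interior (\<gamma> f) = {})) \<and>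
     (\<forall>e\<in>edges G. \<forall>f\<in>edges G. \<forall>g\<in>edges G. e \<noteq> f \<and> e \<noteq> g \<and> f \<noteq> g \<longrightarrow>
        arc_interior (\<gamma> e) \<inter> arc_interior (\<gamma> f) \<inter> arc_interior (\<gamma> g) = {})"

text \<open>In a drawing, every common internal point of two edges is a crossing, and it lies on no
  third edge; so crossings can be counted as points of the plane.\<close>

definition crossings :: "('v, 'e) multigraph \<Rightarrow> ('e \<Rightarrow> real \<Rightarrow> complex) \<Rightarrow> complex set" where
  "crossings G \<gamma> =
     {p. \<exists>e\<in>edges G. \<exists>f\<in>edges G. e \<noteq> f \<and> p \<in> arc_interior (\<gamma> e) \<inter> arc_interior (\<gamma> f)}"

definition edges_cross :: "('e \<Rightarrow> real \<Rightarrow> complex) \<Rightarrow> 'e \<Rightarrow> 'e \<Rightarrow> bool" where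
  "edges_cross \<gamma> e f \<longleftrightarrow> e \<noteq> f \<and> arc_interior (\<gamma> e) \<inter> arc_interior (\<gamma> f) \<noteq> {}"

text \<open>\<open>C\<close> is a simple closed curve formed by one part of \<open>g1\<close> and one part of \<open>g2\<close>; these may be
  the entire curves.\<close>

definition lens_boundary :: "(real \<Rightarrow> complex) \<Rightarrow> (real \<Rightarrow> complex) \<Rightarrow> complex set \<Rightarrow> bool" where
  "lens_boundary g1 g2 C \<longleftrightarrow>
     (\<exists>a b. arc a \<and> arc b \<and> path_image a \<subseteq> path_image g1 \<and> path_image b \<subseteq> path_image g2 \<and>
        pathstart a = pathstart b \<and> pathfinish a = pathfinish b \<and>
        path_image a \<inter> path_image b = {pathstart a, pathfinish a} \<and>
        C = path_image a \<union> path_image b)"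

text \<open>By the Jordan curve theorem the regions with boundary \<open>C\<close> are the two components of its
  complement. Both, not only the bounded one, have to contain a vertex or a crossing; as
  components are open, they are their own interiors.\<close>

definition non_homotopic ::
  "('v, 'e) multigraph \<Rightarrow> ('v \<Rightarrow> complex) \<Rightarrow> ('e \<Rightarrow> real \<Rightarrow> complex) \<Rightarrow> bool" where
  "non_homotopic G pos \<gamma> \<longleftrightarrow>
     (\<forall>e\<in>edges G. \<forall>f\<in>edges G. \<forall>C R.
        e \<noteq> f \<and> lens_boundary (\<gamma> e) (\<gamma> f) C \<and> R \<in> components (- C) \<longrightarrow>
        R \<inter> (pos ` verts G \<union> crossings G \<gamma>) \<noteq> {})"

definition colorable_plane ::
  "nat \<Rightarrow> nat \<Rightarrow> ('v, 'e) multigraph \<Rightarrow> ('e \<Rightarrow> real \<Rightarrow> complex) \<Rightarrow> bool" where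
  "colorable_plane t k G \<gamma> \<longleftrightarrow>
     (\<exists>\<phi>. \<phi> ` edges G \<subseteq> {1..t} \<and>
        (\<forall>e\<in>edges G. \<forall>c\<in>{1..t}. card {f \<in> edges G. \<phi> f = c \<and> edges_cross \<gamma> e f} \<le> k))"

end

theory Submission imports Defs begin

text \<open>
The idea is that a plane graph all of whose faces are octagons, with all eight short diagonals drawn
in every face, has the required numbers of edges and crossings. By Euler's formula such a graph on
\<open>n\<close> vertices has \<open>4/3 (n - 2)\<close> edges and \<open>(n - 2)/3\<close> faces; each face contributes \<open>8\<close>
diagonals and \<open>8\<close> crossings, which makes \<open>4 (n - 2)\<close> edges and \<open>8/3 (n - 2)\<close> crossings. Inside one
octagon each diagonal crosses exactly its predecessor and its successor in the cyclic order, so the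
colors \<open>1, 1, 2, 2, 1, 1, 2, 2\<close> give every diagonal one crossing partner of each color.

A graph of this kind on \<open>2 + 6 l\<close> vertices consists of two poles joined by \<open>l\<close> edges and by
\<open>l\<close> paths of length \<open>7\<close>, in alternation around the poles. One edge, the path after it
and the \<open>16\<close> diagonals on both sides of that path form a tile. The
tile has a concrete drawing with integer coordinates in which every edge is a path with
one bend. The edges fit into a lune between the poles \<open>(0, 168)\<close> and \<open>(0, -168)\<close>, and
scaling the real axis by powers of \<open>22\<close> moves the tile into lunes that meet only at
the poles. These maps are linear, so everything about the drawing reduces to the tile
(\<open>curve_interiors_meet\<close>, \<open>curves_meet_copies\<close>), and there
to a finite calculation with orientations of triples of integer points (\<open>tile_meetings_check\<close>,
\<open>tile_crossings_check\<close>).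

Adjacent edges do not cross and crossing edges cross once, so two edges with two common points
have the same ends, and a lens consists of two entire parallel edges (\<open>common_pair_is_ends\<close>). If
  they
belong to one tile, they are a diagonal on the inner side and the diagonal with the same ends on the
outer side; they bound a triangle with some corners of the octagon inside and some outside. If
they belong to different tiles, they are two of the edges between the poles; these bound a
chevron, and the path of one of the two tiles runs inside it and that of the other
outside. In both cases the complement of the lens boundary is a union
of two explicit connected sets which both contain vertices (\<open>two_sided\<close>).
\<close>

section \<open>Segments and orientation\<close>

text \<open>Twice the signed area of the triangle \<open>a b c\<close>.\<close>

definition orient :: "complex \<Rightarrow> complex \<Rightarrow> complex \<Rightarrow> real" where
  "orient a b c = (Re b - Re a) * (Im c - Im a) - (Im b - Im a) * (Re c - Re a)"

lemma orient_convex: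
  "orient a b ((1 - u) *\<^sub>R c + u *\<^sub>R d) = (1 - u) * orient a b c + u * orient a b d"
  by (simp add: orient_def) (simp add: algebra_simps)

lemma orient_degenerate [simp]: "orient a b a = 0" "orient a b b = 0" "orient a a c = 0"
  by (simp_all add: orient_def)

lemma orient_on_segment: "z \<in> closed_segment a b \<Longrightarrow> orient a b z = 0"
  by (auto simp: in_segment orient_convex)

lemma orient_rotate: "orient b c a = orient a b c"
  by (simp add: orient_def algebra_simps)

lemma convex_halfplane: "convex {z. 0 < orient a b z * k}"
  unfolding convex_alt
proof (intro ballI allI impI CollectI)
  fix y z u assume "y \<in> {z. 0 < orient a b z * k}" "z \<in> {z. 0 < orient a b z * k}"
    and u: "0 \<le> u \<and> u \<le> (1::real)"
  then have "(1 - u) *\<^sub>R (orient a b y * k) + u *\<^sub>R (orient a b z * k) \<in> {0<..}"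
    by (intro convexD_alt) auto
  then show "0 < orient a b ((1 - u) *\<^sub>R y + u *\<^sub>R z) * k"
    unfolding orient_convex by (simp add: algebra_simps)
qed

text \<open>If both ends of one segment lie strictly on the same side of the line through the other, the
whole segment does, because the orientation is affine in its last argument.\<close>

lemma segments_apart:
  assumes "0 < orient a b c * orient a b d"
  shows "closed_segment a b \<inter> closed_segment c d = {}"
proof -
  have False if z: "z \<in> closed_segment a b" "z \<in> closed_segment c d" for z
  proof -
    obtain u where u: "0 \<le> u" "u \<le> 1" "z = (1 - u) *\<^sub>R c + u *\<^sub>R d"
      using z(2) by (auto simp: in_segment)
    have 0: "(1 - u) * orient a b c + u * orient a b d = 0"
      using orient_on_segment[OF z(1)] by (simp add: u(3) orient_convex)
    have "(1 - u) * orient a b c * orient a b c + u * (orient a b c * orient a b d) = 0"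
      using 0 by algebra
    moreover have "0 \<le> (1 - u) * orient a b c * orient a b c"
      using u by (simp add: mult.assoc)
    moreover have "0 \<le> u * (orient a b c * orient a b d)"
      using u assms by simp
    ultimately have "u * (orient a b c * orient a b d) = 0"
      "(1 - u) * orient a b c * orient a b c = 0"
      by linarith+
    then show False using assms by auto
  qed
  then show ?thesis by blast
qed

text \<open>A point on both lines is determined by two linear equations; their determinant is the cross
product of the directions of the lines, which is the difference of the two orientations.\<close>

lemma lines_meet_once:
  assumes "orient a b c \<noteq> orient a b d"
    and "orient a b x = 0" "orient c d x = 0" "orient a b z = 0" "orient c d z = 0"
  shows "z = x"
proof -
  define D where "D = orient a b d - orient a b c"
  have "D * (Re z - Re x) = 0" "D * (Im z - Im x) = 0"
    using assms(2-5) unfolding D_def orient_def by algebra+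
  moreover have "D \<noteq> 0" using assms(1) by (simp add: D_def)
  ultimately show ?thesis by (simp add: complex_eq_iff)
qed

lemma segments_meet_once:
  assumes "orient a b c \<noteq> orient a b d" "orient a b x = 0" "orient c d x = 0"
  shows "closed_segment a b \<inter> closed_segment c d \<subseteq> {x}"
  using lines_meet_once[OF assms] orient_on_segment by blast

text \<open>On a line, being strictly between two points is a sign condition on an inner product. In this
form it can be checked with integer arithmetic.\<close>

lemma open_segment_if_orient_zero:
  assumes "orient a b x = 0" "(x - a) \<bullet> (b - x) > 0"
  shows "x \<in> open_segment a b"
proof -
  define d where "d = (b - a) \<bullet> (b - a)"
  define t where "t = (x - a) \<bullet> (b - a) / d"
  have "a \<noteq> b" using assms(2)
    by (metis inner_ge_zero inner_minus_left minus_diff_eq not_less neg_le_0_iff_le)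
  then have d: "d > 0" by (simp add: d_def)
  have s1: "(x - a) \<bullet> (b - a) = (x - a) \<bullet> (b - x) + (x - a) \<bullet> (x - a)"
    by (simp add: inner_simps)
  have s2: "d - (x - a) \<bullet> (b - a) = (x - a) \<bullet> (b - x) + (b - x) \<bullet> (b - x)"
    unfolding d_def by (simp add: inner_simps inner_commute)
  have "0 < (x - a) \<bullet> (b - a)" "0 < d - (x - a) \<bullet> (b - a)"
    using s1 s2 assms(2) inner_ge_zero[of "x - a"] inner_ge_zero[of "b - x"] by linarith+
  then have t: "0 < t" "t < 1" using d by (simp_all add: t_def)
  have "d * (Re x - Re a) = ((x - a) \<bullet> (b - a)) * (Re b - Re a)"
       "d * (Im x - Im a) = ((x - a) \<bullet> (b - a)) * (Im b - Im a)"
    using assms(1) unfolding d_def orient_def inner_complex_def by (simp_all, algebra+)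
  then have "Re x - Re a = t * (Re b - Re a)" "Im x - Im a = t * (Im b - Im a)"
    unfolding t_def using d by (simp_all add: eq_divide_eq mult.commute)
  then have "x = a + t *\<^sub>R (b - a)" by (simp add: complex_eq_iff algebra_simps)
  then have "x = (1 - t) *\<^sub>R a + t *\<^sub>R b" by (simp add: algebra_simps)
  with t \<open>a \<noteq> b\<close> show ?thesis by (auto simp: in_segment)
qed

text \<open>The second alternative admits the bend of \<open>180\<close> degrees, for edges that are straight.\<close>

lemma segments_at_bend:
  assumes "orient a b c \<noteq> 0 \<or> (a - b) \<bullet> (c - b) < 0"
  shows "closed_segment a b \<inter> closed_segment b c \<subseteq> {b}"
proof
  fix z assume "z \<in> closed_segment a b \<inter> closed_segment b c"
  then obtain u v where uv: "0 \<le> u" "u \<le> 1" "0 \<le> v" "v \<le> 1"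
    "z = (1 - u) *\<^sub>R b + u *\<^sub>R a" "z = (1 - v) *\<^sub>R b + v *\<^sub>R c"
    by (metis IntD1 IntD2 closed_segment_commute in_segment(1))
  have eq: "u *\<^sub>R (a - b) = v *\<^sub>R (c - b)"
    using uv(5,6) by (simp add: algebra_simps)
  from assms have "u = 0"
  proof
    assume n: "orient a b c \<noteq> 0"
    have "u * orient a b c = 0"
      using eq unfolding orient_def complex_eq_iff by (simp, algebra)
    with n show ?thesis by simp
  next
    assume n: "(a - b) \<bullet> (c - b) < 0"
    have "(u *\<^sub>R (a - b)) \<bullet> (a - b) = v * ((a - b) \<bullet> (c - b))"
      unfolding eq by (simp add: inner_commute)
    moreover have "v * ((a - b) \<bullet> (c - b)) \<le> 0" using n uv(3) by (simp add: mult_nonneg_nonpos)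
    moreover have "0 \<le> u * ((a - b) \<bullet> (a - b))" using uv(1) by simp
    ultimately have "u * ((a - b) \<bullet> (a - b)) = 0" by simp
    moreover have "a \<noteq> b" using n by auto
    ultimately show ?thesis by simp
  qed
  then show "z \<in> {b}" using uv(5) by simp
qed

section \<open>Paths with one bend\<close>

definition bent_path :: "complex \<Rightarrow> complex \<Rightarrow> complex \<Rightarrow> real \<Rightarrow> complex" where
  "bent_path a b c = linepath a b +++ linepath b c"

lemma arc_interior_compose:
  assumes "inj T" shows "arc_interior (T \<circ> g) = T ` arc_interior g"
  unfolding arc_interior_def path_image_compose pathstart_compose pathfinish_compose
  using assms by (auto simp: inj_eq)

lemma arc_interior_subset: "arc_interior g \<subseteq> path_image g"
  by (auto simp: arc_interior_def)

lemma path_image_bent_path: "path_image (bent_path a b c) = closed_segment a b \<union> closed_segment b c"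
  by (simp add: bent_path_def path_image_join)

lemma ends_bent_path [simp]: "pathstart (bent_path a b c) = a" "pathfinish (bent_path a b c) = c"
  by (simp_all add: bent_path_def)

lemma arc_bent_path:
  assumes "orient a b c \<noteq> 0 \<or> (a - b) \<bullet> (c - b) < 0"
  shows "arc (bent_path a b c)"
proof -
  have "a \<noteq> b" "b \<noteq> c" using assms by auto
  then show ?thesis unfolding bent_path_def
    using segments_at_bend[OF assms] by (intro arc_join) auto
qed

section \<open>Crossings and subarcs\<close>

text \<open>Near a proper crossing of two segments, affine coordinates along the segments form the required
homeomorphism onto a disc. The rest of each curve is closed and misses the crossing, so it stays
outside a small disc.\<close>

lemma cross_at_straight_pieces:
  assumes im1: "path_image g1 = closed_segment a b \<union> A" "closed A" "x \<notin> A"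
    and im2: "path_image g2 = closed_segment c d \<union> B" "closed B" "x \<notin> B"
    and x: "x \<in> open_segment a b" "x \<in> open_segment c d"
    and np: "orient a b c \<noteq> orient a b d"
  shows "cross_at x g1 g2"
proof -
  define p q where "p = b - a" and "q = d - c"
  define D where "D = Re p * Im q - Im p * Re q"
  have "D = orient a b d - orient a b c" by (simp add: D_def p_def q_def orient_def algebra_simps)
  with np have D: "D \<noteq> 0" by simp
  obtain s where s: "0 < s" "s < 1" "x = (1 - s) *\<^sub>R a + s *\<^sub>R b" using x(1)
    by (auto simp: in_segment)
  obtain t where t: "0 < t" "t < 1" "x = (1 - t) *\<^sub>R c + t *\<^sub>R d" using x(2)
    by (auto simp: in_segment)
  define F where "F = (\<lambda>w::complex. x + Re w *\<^sub>R p + Im w *\<^sub>R q)"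
  define G where "G = (\<lambda>z::complex. Complex ((Re (z - x) * Im q - Im (z - x) * Re q) / D)
      ((Re p * Im (z - x) - Im p * Re (z - x)) / D))"
  have GF: "G (F w) = w" for w
    using D by (auto simp: complex_eq_iff F_def G_def field_simps) (simp_all add: D_def
      algebra_simps)
  have FG: "F (G z) = z" for z
  proof -
    have "D * Re (F (G z)) = D * Re z" "D * Im (F (G z)) = D * Im z"
      using D by (simp_all add: F_def G_def field_simps) (simp_all add: D_def algebra_simps)
    with D show ?thesis by (simp add: complex_eq_iff)
  qed
  have F0: "F 0 = x" by (simp add: F_def)
  have contF: "continuous_on S F" for S unfolding F_def by (intro continuous_intros)
  have contG: "continuous_on S G" for S unfolding G_def Complex_eq
    by (intro continuous_intros) (use D in auto)
  have opn: "open (F -` (- (A \<union> B)))"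
    using im1(2) im2(2) by (intro open_vimage contF) auto
  have "0 \<in> F -` (- (A \<union> B))" using im1(3) im2(3) F0 by simp
  with opn obtain e where e: "e > 0" "ball 0 e \<subseteq> F -` (- (A \<union> B))"
    using open_contains_ball by blast
  \<comment> \<open>In the coordinates along the two segments, a disc of this radius stays within both segments
    and away from the other pieces.\<close>
  define r where "r = Min {e, s, 1 - s, t, 1 - t}"
  have r: "r > 0" "r \<le> e" "r \<le> s" "r \<le> 1 - s" "r \<le> t" "r \<le> 1 - t"
    using e s t by (auto simp: r_def)
  define k where "k = (\<lambda>w::complex. F (r *\<^sub>R w))"
  define h where "h = (\<lambda>z. (1 / r) *\<^sub>R G z)"
  define U where "U = k ` ball 0 1"
  have hk: "h (k w) = w" for w using r by (simp add: h_def k_def GF)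
  have kh: "k (h z) = z" for z using r by (simp add: h_def k_def FG)
  have contk: "continuous_on S k" for S unfolding k_def
    by (intro continuous_on_compose2[OF contF[of UNIV]] continuous_intros) auto
  have conth: "continuous_on S h" for S unfolding h_def
    by (intro continuous_intros contG)
  have U: "U = h -` ball 0 1"
  proof
    show "U \<subseteq> h -` ball 0 1" using hk by (auto simp: U_def)
    show "h -` ball 0 1 \<subseteq> U" unfolding U_def by (metis image_eqI kh subsetI vimageD)
  qed
  have "open U" unfolding U by (intro open_vimage conth) auto
  moreover have "x \<in> U" unfolding U_def using F0 by (auto simp: k_def intro!: image_eqI[of _ _ 0])
  moreover have "homeomorphism U (ball 0 1) h k"
    unfolding homeomorphism_def using hk kh conth contk by (auto simp: U_def image_image)
  moreover have "h x = 0" using hk[of 0] F0 by (simp add: k_def)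
  moreover have avoid: "k w \<notin> A \<union> B" if "w \<in> ball 0 1" for w
  proof -
    have "norm (r *\<^sub>R w) < e"
      using that r by (simp add: mult_le_less_imp_less[of r e "norm w" 1, simplified])
    then show ?thesis using subsetD[OF e(2), of "r *\<^sub>R w"] by (simp add: k_def)
  qed
  have im_h: "h ` (U \<inter> S) = {w \<in> ball 0 1. k w \<in> S}" for S
  proof -
    have "U \<inter> S = k ` {w \<in> ball 0 1. k w \<in> S}" by (auto simp: U_def)
    then show ?thesis by (simp add: image_image hk)
  qed
  have small: "\<bar>Re w\<bar> < 1" "\<bar>Im w\<bar> < 1" if "w \<in> ball 0 1" for w :: complex
    using that abs_Re_le_cmod[of w] abs_Im_le_cmod[of w] by auto
  have on1: "k w \<in> closed_segment a b \<longleftrightarrow> Im w = 0" if w: "w \<in> ball 0 1" for w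
  proof
    assume "k w \<in> closed_segment a b"
    then obtain u where "k w = (1 - u) *\<^sub>R a + u *\<^sub>R b" by (auto simp: in_segment)
    then have "k w = x + (u - s) *\<^sub>R p" by (simp add: s(3) p_def algebra_simps)
    then have "k w = F (of_real (u - s))" by (simp add: F_def)
    then have "r *\<^sub>R w = of_real (u - s)" by (metis GF k_def)
    then show "Im w = 0" using r by (simp add: complex_eq_iff)
  next
    assume "Im w = 0"
    then have "k w = (1 - (s + r * Re w)) *\<^sub>R a + (s + r * Re w) *\<^sub>R b"
      by (simp add: k_def F_def s(3) p_def algebra_simps)
    moreover have "\<bar>r * Re w\<bar> \<le> r" using small[OF w] r(1) by (simp add: abs_mult)
    then have "0 \<le> s + r * Re w" "s + r * Re w \<le> 1" using r by linarith+
    ultimately show "k w \<in> closed_segment a b" by (auto simp: in_segment)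
  qed
  have on2: "k w \<in> closed_segment c d \<longleftrightarrow> Re w = 0" if w: "w \<in> ball 0 1" for w
  proof
    assume "k w \<in> closed_segment c d"
    then obtain u where "k w = (1 - u) *\<^sub>R c + u *\<^sub>R d" by (auto simp: in_segment)
    then have "k w = x + (u - t) *\<^sub>R q" by (simp add: t(3) q_def algebra_simps)
    then have "k w = F (Complex 0 (u - t))" by (simp add: F_def)
    then have "r *\<^sub>R w = Complex 0 (u - t)" by (metis GF k_def)
    then show "Re w = 0" using r by (simp add: complex_eq_iff)
  next
    assume "Re w = 0"
    then have "k w = (1 - (t + r * Im w)) *\<^sub>R c + (t + r * Im w) *\<^sub>R d"
      by (simp add: k_def F_def t(3) q_def algebra_simps)
    moreover have "\<bar>r * Im w\<bar> \<le> r" using small[OF w] r(1) by (simp add: abs_mult)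
    then have "0 \<le> t + r * Im w" "t + r * Im w \<le> 1" using r by linarith+
    ultimately show "k w \<in> closed_segment c d" by (auto simp: in_segment)
  qed
  have "h ` (U \<inter> path_image g1) = {z \<in> ball 0 1. Im z = 0}"
    unfolding im_h im1(1) using avoid on1 by blast
  moreover have "h ` (U \<inter> path_image g2) = {z \<in> ball 0 1. Re z = 0}"
    unfolding im_h im2(1) using avoid on2 by blast
  ultimately show ?thesis unfolding cross_at_def by blast
qed

text \<open>Both sides are the cross product of the directions \<open>b - a\<close> and \<open>d - c\<close>.\<close>

lemma crossing_direction_commute: "orient c d a - orient c d b = orient a b d - orient a b c"
  by (simp add: orient_def algebra_simps)

lemma cross_at_image:
  assumes T: "homeomorphism UNIV UNIV T T'" and "cross_at p g1 g2"
  shows "cross_at (T p) (T \<circ> g1) (T \<circ> g2)"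
proof -
  obtain U h k where U: "open U" "p \<in> U" "homeomorphism U (ball 0 1) h k" "h p = 0"
    "h ` (U \<inter> path_image g1) = {z \<in> ball 0 1. Im z = 0}"
    "h ` (U \<inter> path_image g2) = {z \<in> ball 0 1. Re z = 0}"
    using assms(2) unfolding cross_at_def by blast
  have T'T: "T' (T z) = z" for z using T by (simp add: homeomorphism_def)
  have TT': "T (T' z) = z" for z using T by (simp add: homeomorphism_def)
  have "T ` U = T' -` U" using T'T TT' by (auto simp: image_iff) metis
  then have "open (T ` U)" using T U(1) by (simp add: open_vimage homeomorphism_def)
  moreover have "homeomorphism (T ` U) U T' T"
    using T T'T TT' unfolding homeomorphism_def
    by (auto simp: image_image intro: continuous_on_subset)
  then have "homeomorphism (T ` U) (ball 0 1) (h \<circ> T') (T \<circ> k)"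
    using U(3) by (rule homeomorphism_compose)
  moreover have "(h \<circ> T') ` (T ` U \<inter> path_image (T \<circ> g)) = h ` (U \<inter> path_image g)" for g
  proof -
    have "T ` U \<inter> T ` path_image g = T ` (U \<inter> path_image g)"
      using T'T by (intro image_Int[symmetric] inj_on_inverseI[where g = T'])
    then show ?thesis by (simp add: path_image_compose image_image T'T)
  qed
  ultimately show ?thesis unfolding cross_at_def using U
    by (intro exI[of _ "T ` U"] exI[of _ "h \<circ> T'"] exI[of _ "T \<circ> k"]) (auto simp: T'T)
qed

text \<open>Pulled back along \<open>g\<close>, the image of \<open>a\<close> becomes a connected subset of the unit interval
that contains \<open>0\<close> and \<open>1\<close>.\<close>

lemma arc_subset_same_ends:
  fixes g a :: "real \<Rightarrow> 'a::t2_space"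
  assumes "arc g" "arc a" "path_image a \<subseteq> path_image g"
    and "{pathstart g, pathfinish g} \<subseteq> path_image a"
  shows "path_image a = path_image g"
proof -
  obtain h where h: "homeomorphism {0..1} (path_image g) g h"
    using homeomorphism_arc[OF assms(1)] .
  have "connected (h ` path_image a)"
    by (intro connected_continuous_image connected_path_image arc_imp_path assms
        continuous_on_subset[OF homeomorphism_cont2[OF h]])
  moreover have "0 \<in> h ` path_image a" "1 \<in> h ` path_image a"
    using assms(4) h by (force simp: pathstart_def pathfinish_def homeomorphism_def image_iff)+
  ultimately have sub: "{0..1} \<subseteq> h ` path_image a" using connected_contains_Icc by blast
  have "path_image g \<subseteq> path_image a"
  proof
    fix z assume z: "z \<in> path_image g"
    then have "h z \<in> {0..1}" using h by (auto simp: homeomorphism_def)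
    then obtain y where "y \<in> path_image a" "h y = h z" using sub by fastforce
    then show "z \<in> path_image a" using z assms(3) h
      by (metis homeomorphism_apply2 subsetD)
  qed
  with assms(3) show ?thesis by blast
qed

section \<open>Closed curves with points on both sides\<close>

text \<open>For the curves \<open>C\<close> in question the two sides can be written down. Every component of the
complement then contains one of them, which turns the condition on all components into the
choice of one point on each side.\<close>

definition two_sided :: "complex set \<Rightarrow> complex set \<Rightarrow> bool" where
  "two_sided C W \<longleftrightarrow> (\<exists>D E. connected D \<and> connected E \<and> - C = D \<union> E \<and>
     D \<inter> W \<noteq> {} \<and> E \<inter> W \<noteq> {})"

lemma two_sided_components:
  assumes "two_sided C W" "R \<in> components (- C)"
  shows "R \<inter> W \<noteq> {}"
proof -
  obtain D E where DE: "connected D" "connected E" "- C = D \<union> E" "D \<inter> W \<noteq> {}" "E \<inter> W \<noteq> {}"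
    using assms(1) by (auto simp: two_sided_def)
  have max: "S \<subseteq> R" if "connected S" "S \<subseteq> - C" "S \<inter> R \<noteq> {}" for S
    using components_maximal[OF assms(2)] that by blast
  have "R \<noteq> {}" "R \<subseteq> D \<union> E"
    using in_components_nonempty in_components_subset assms(2) DE(3) by metis+
  then have "D \<subseteq> R \<or> E \<subseteq> R" using max[of D] max[of E] DE by blast
  with DE show ?thesis by blast
qed

lemma two_sided_image:
  assumes T: "homeomorphism UNIV UNIV T T'" and "two_sided C W"
  shows "two_sided (T ` C) (T ` W)"
proof -
  obtain D E where DE: "connected D" "connected E" "- C = D \<union> E" "D \<inter> W \<noteq> {}" "E \<inter> W \<noteq> {}"
    using assms(2) by (auto simp: two_sided_def)
  have "bij T" using T unfolding homeomorphism_def by (metis UNIV_I bijI' )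
  then have "- (T ` C) = T ` D \<union> T ` E"
    using DE(3) by (metis bij_image_Compl_eq image_Un)
  moreover have "connected (T ` D)" "connected (T ` E)"
    using T DE by (auto intro!: connected_continuous_image simp: homeomorphism_def intro:
      continuous_on_subset)
  ultimately show ?thesis unfolding two_sided_def using DE(4,5) by blast
qed

lemma two_sided_mono: "two_sided C W \<Longrightarrow> W \<subseteq> W' \<Longrightarrow> two_sided C W'"
  unfolding two_sided_def by blast

text \<open>The orientations of \<open>z\<close> with respect to the three sides, divided by that of the
triangle, are the barycentric coordinates of \<open>z\<close>.\<close>

lemma triangle_side_iff:
  assumes D: "orient a b c \<noteq> 0"
  shows "z \<in> closed_segment a b \<longleftrightarrow>
     orient a b z = 0 \<and> 0 \<le> orient b c z * orient a b c \<and> 0 \<le> orient c a z * orient a b c"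
proof
  assume z: "z \<in> closed_segment a b"
  then obtain u where u: "0 \<le> u" "u \<le> 1" "z = (1 - u) *\<^sub>R a + u *\<^sub>R b" by (auto simp: in_segment)
  show "orient a b z = 0 \<and> 0 \<le> orient b c z * orient a b c \<and> 0 \<le> orient c a z * orient a b c"
    using orient_on_segment[OF z] u
    by (simp add: u(3) orient_convex orient_rotate[of a b c] orient_rotate[of c a b, symmetric]
      mult.assoc)
next
  assume *: "orient a b z = 0 \<and> 0 \<le> orient b c z * orient a b c \<and> 0 \<le> orient c a z * orient a b c"
  define t where "t = orient c a z / orient a b c"
  have sum: "orient b c z + orient c a z + orient a b z = orient a b c"
    by (simp add: orient_def algebra_simps)
  have "orient a b c * Re z = orient b c z * Re a + orient c a z * Re b + orient a b z * Re c"
       "orient a b c * Im z = orient b c z * Im a + orient c a z * Im b + orient a b z * Im c"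
    unfolding orient_def by algebra+
  moreover have t': "1 - t = orient b c z / orient a b c"
    using D sum * by (simp add: t_def field_simps)
  ultimately have "z = (1 - t) *\<^sub>R a + t *\<^sub>R b"
    using D * unfolding t' by (simp add: complex_eq_iff t_def field_simps)
  moreover have "0 \<le> t" "0 \<le> 1 - t"
    using * unfolding t' unfolding t_def by (auto simp: zero_le_divide_iff zero_le_mult_iff)
  ultimately show "z \<in> closed_segment a b" by (auto simp: in_segment)
qed

text \<open>The inside is an intersection of three open half-planes; the outside is the union
of the opposite half-planes, any two of which overlap beyond a corner of the triangle.\<close>

lemma two_sided_triangle:
  assumes v: "v \<in> W" "0 < orient a b v * orient a b c" "0 < orient b c v * orient a b c"
      "0 < orient c a v * orient a b c"
    and w: "w \<in> W" "orient a b w * orient a b c < 0 \<or> orient b c w * orient a b c < 0 \<or>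
      orient c a w * orient a b c < 0"
  shows "two_sided (closed_segment a b \<union> closed_segment b c \<union> closed_segment c a) W"
proof -
  define D where "D = orient a b c"
  have rot: "orient b c a = D" "orient c a b = D"
    by (simp_all add: D_def orient_def algebra_simps)
  have D0: "D \<noteq> 0" using v(2) unfolding D_def by auto
  then have DD: "0 < D * D" by (metis not_real_square_gt_zero)
  define H where "H = (\<lambda>p q. {z. 0 < orient p q z * D})"
  define K where "K = (\<lambda>p q. {z. 0 < orient p q z * - D})"
  have conv: "convex (H p q)" "convex (K p q)" for p q
    unfolding H_def K_def by (rule convex_halfplane)+
  define E where "E = K a b \<union> K b c \<union> K c a"
  have "connected (H a b \<inter> H b c \<inter> H c a)"
    by (intro convex_connected convex_Int conv)
  moreover have "connected E"
  proof -
    have neg: "3 * q - p - r \<in> K p q" "3 * q - p - r \<in> K q r" if "orient p q r = D" for p q r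
    proof -
      have "orient p q (3 * q - p - r) = - D" "orient q r (3 * q - p - r) = - D"
        unfolding that[symmetric] by (simp_all add: orient_def algebra_simps)
      with DD show "3 * q - p - r \<in> K p q" "3 * q - p - r \<in> K q r" by (simp_all add: K_def)
    qed
    have "K a b \<inter> K b c \<noteq> {}" "(K a b \<union> K b c) \<inter> K c a \<noteq> {}"
      using neg[of a b c] neg[of b c a] rot by (auto simp: D_def[symmetric])
    then show ?thesis unfolding E_def by (intro connected_Un convex_connected conv)
  qed
  moreover have "- (closed_segment a b \<union> closed_segment b c \<union> closed_segment c a)
      = (H a b \<inter> H b c \<inter> H c a) \<union> E"
  proof -
    have "z \<in> closed_segment a b \<union> closed_segment b c \<union> closed_segment c a \<longleftrightarrow>
      z \<notin> (H a b \<inter> H b c \<inter> H c a) \<union> E" for z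
      using triangle_side_iff[of a b c z] triangle_side_iff[of b c a z] triangle_side_iff[of c a b
        z] D0
      unfolding rot D_def[symmetric] E_def H_def K_def
      by (auto simp: not_less)
    then show ?thesis by blast
  qed
  moreover have "v \<in> H a b \<inter> H b c \<inter> H c a" "w \<in> E"
    using v w by (auto simp: H_def K_def E_def D_def)
  ultimately show ?thesis unfolding two_sided_def using v(1) w(1) by blast
qed

text \<open>The two curves are graphs over the imaginary axis that join the same two points. The region
between them is the image of a rectangle under \<open>(t, y) \<mapsto> (t (h - \<bar>y\<bar>), y)\<close>.\<close>

lemma two_sided_chevron:
  fixes a b h :: real
  assumes ab: "0 \<le> a" "a < b" and h: "0 < h"
    and v: "v \<in> W" "a * (h - \<bar>Im v\<bar>) < Re v" "Re v < b * (h - \<bar>Im v\<bar>)"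
    and w: "w \<in> W" "b * (h - \<bar>Im w\<bar>) < Re w"
  shows "two_sided ({z. \<bar>Im z\<bar> \<le> h \<and> Re z = a * (h - \<bar>Im z\<bar>)} \<union>
    {z. \<bar>Im z\<bar> \<le> h \<and> Re z = b * (h - \<bar>Im z\<bar>)}) W"
proof -
  define D where "D = {z. a * (h - \<bar>Im z\<bar>) < Re z \<and> Re z < b * (h - \<bar>Im z\<bar>)}"
  define L where "L = {z. Re z < a * (h - \<bar>Im z\<bar>)}"
  define R where "R = {z. b * (h - \<bar>Im z\<bar>) < Re z}"
  have "D = (\<lambda>(t, y). Complex (t * (h - \<bar>y\<bar>)) y) ` ({a<..<b} \<times> {- h<..<h})"
  proof (intro equalityI subsetI)
    fix z assume z: "z \<in> D"
    then have "0 < (b - a) * (h - \<bar>Im z\<bar>)" by (simp add: D_def algebra_simps)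
    then have y: "0 < h - \<bar>Im z\<bar>" using ab by (simp add: zero_less_mult_iff)
    then have "Re z / (h - \<bar>Im z\<bar>) \<in> {a<..<b}" "Im z \<in> {- h<..<h}"
      using z by (auto simp: D_def pos_less_divide_eq pos_divide_less_eq)
    moreover have "z = Complex (Re z / (h - \<bar>Im z\<bar>) * (h - \<bar>Im z\<bar>)) (Im z)"
      using y by (simp add: complex_eq_iff)
    ultimately show "z \<in> (\<lambda>(t, y). Complex (t * (h - \<bar>y\<bar>)) y) ` ({a<..<b} \<times> {- h<..<h})"
      by (intro image_eqI[of _ _ "(Re z / (h - \<bar>Im z\<bar>), Im z)"]) auto
  qed (auto simp: D_def intro!: mult_strict_right_mono)
  moreover have "connected ((\<lambda>(t, y). Complex (t * (h - \<bar>y\<bar>)) y) ` ({a<..<b} \<times> {- h<..<h}))"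
    unfolding Complex_eq split_beta
    by (intro connected_continuous_image connected_Times continuous_intros) auto
  ultimately have D: "connected D" by simp
  have "L = (\<lambda>(t, y). Complex (a * (h - \<bar>y\<bar>) - t) y) ` ({0<..} \<times> UNIV)"
  proof (intro equalityI subsetI)
    fix z assume "z \<in> L"
    then show "z \<in> (\<lambda>(t, y). Complex (a * (h - \<bar>y\<bar>) - t) y) ` ({0<..} \<times> UNIV)"
      by (intro image_eqI[of _ _ "(a * (h - \<bar>Im z\<bar>) - Re z, Im z)"]) (auto simp: L_def)
  qed (auto simp: L_def)
  moreover have "connected ((\<lambda>(t, y). Complex (a * (h - \<bar>y\<bar>) - t) y) ` ({0<..} \<times> UNIV))"
    unfolding Complex_eq split_beta
    by (intro connected_continuous_image connected_Times continuous_intros) auto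
  ultimately have L: "connected L" by simp
  have "R = (\<lambda>(t, y). Complex (b * (h - \<bar>y\<bar>) + t) y) ` ({0<..} \<times> UNIV)"
  proof (intro equalityI subsetI)
    fix z assume "z \<in> R"
    then show "z \<in> (\<lambda>(t, y). Complex (b * (h - \<bar>y\<bar>) + t) y) ` ({0<..} \<times> UNIV)"
      by (intro image_eqI[of _ _ "(Re z - b * (h - \<bar>Im z\<bar>), Im z)"]) (auto simp: R_def)
  qed (auto simp: R_def)
  moreover have "connected ((\<lambda>(t, y). Complex (b * (h - \<bar>y\<bar>) + t) y) ` ({0<..} \<times> UNIV))"
    unfolding Complex_eq split_beta
    by (intro connected_continuous_image connected_Times continuous_intros) auto
  ultimately have R: "connected R" by simp
  \<comment> \<open>Above the apex, the graphs of the two functions of \<open>y\<close> have swapped sides, so \<open>L\<close> and \<open>R\<close>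
    overlap there.\<close>
  have "a * h < b * h" using ab h by simp
  moreover have "- (x + y) / 2 < - x \<and> - y < - (x + y) / 2" if "x < y" for x y :: real
    using that by (simp add: field_simps)
  ultimately have "- (a * h + b * h) / 2 < - (a * h)" "- (b * h) < - (a * h + b * h) / 2"
    by blast+
  moreover have "a * (h - \<bar>2 * h\<bar>) = - (a * h)" "b * (h - \<bar>2 * h\<bar>) = - (b * h)"
    using h by simp_all
  ultimately have "Complex (- (a * h + b * h) / 2) (2 * h) \<in> L \<inter> R"
    by (simp only: L_def R_def complex.sel Int_iff mem_Collect_eq)
  then have "connected (L \<union> R)" by (intro connected_Un L R) blast
  moreover have "- ({z. \<bar>Im z\<bar> \<le> h \<and> Re z = a * (h - \<bar>Im z\<bar>)} \<union>
    {z. \<bar>Im z\<bar> \<le> h \<and> Re z = b * (h - \<bar>Im z\<bar>)}) = D \<union> (L \<union> R)"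
  proof -
    have "(\<bar>Im z\<bar> \<le> h \<and> (Re z = a * (h - \<bar>Im z\<bar>) \<or> Re z = b * (h - \<bar>Im z\<bar>))) \<longleftrightarrow>
      z \<notin> D \<and> z \<notin> L \<and> z \<notin> R" for z
    proof -
      have "(b - a) * (h - \<bar>Im z\<bar>) \<ge> 0 \<longleftrightarrow> \<bar>Im z\<bar> \<le> h"
        using ab by (simp add: zero_le_mult_iff)
      then have "\<bar>Im z\<bar> \<le> h \<longleftrightarrow> a * (h - \<bar>Im z\<bar>) \<le> b * (h - \<bar>Im z\<bar>)"
        unfolding left_diff_distrib by auto
      then show ?thesis unfolding D_def L_def R_def mem_Collect_eq by linarith
    qed
    then show ?thesis by blast
  qed
  moreover have "v \<in> D" "w \<in> L \<union> R" using v w by (auto simp: D_def R_def)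
  ultimately show ?thesis unfolding two_sided_def using D v(1) w(1) by blast
qed

section \<open>The tile in integer coordinates\<close>

text \<open>The corners of a convex octagon on a parabola, from the upper pole \<open>0\<close> to the lower pole
\<open>7\<close>. The factor \<open>24\<close> clears the denominators of all crossings.\<close>

definition corner :: "nat \<Rightarrow> int \<times> int" where
  "corner i = (12 * int i * (7 - int i), 24 * (7 - 2 * int i))"

text \<open>The edges \<open>0\<close> to \<open>7\<close> are the sides of the octagon, the edges \<open>8\<close> to
\<open>15\<close> its inner and \<open>16\<close> to \<open>23\<close> its outer short diagonals; \<open>e mod 8\<close> is the
corner where the edge starts.\<close>

definition tail_of :: "nat \<Rightarrow> nat" where
  "tail_of e = e mod 8"

definition head_of :: "nat \<Rightarrow> nat" where
  "head_of e = (e + (if e < 8 then 1 else 2)) mod 8"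

text \<open>Side \<open>7\<close> joins the poles to the left of the other edges. The remaining sides and the inner
diagonals are straight, with their midpoint as bend. The outer diagonals \<open>16\<close> to
\<open>21\<close> form tents over the corner that they pass; the last two run around all
the tents, and meet each other only on the real axis, far to the right.\<close>

definition bend :: "nat \<Rightarrow> int \<times> int" where
  "bend e =
     (let (x, y) = corner (tail_of e); (x', y') = corner (head_of e) in
      if e = 7 then (24, 0)
      else if e < 16 then ((x + x') div 2, (y + y') div 2)
      else if e < 22 then (fst (corner (e - 15)) + 8, snd (corner (e - 15)))
      else if e = 22 then (384, 24) else (384, -24))"

text \<open>The successor on the same side of the octagon: \<open>15\<close> is followed by \<open>8\<close>, and
\<open>23\<close> by \<open>16\<close>.\<close>

definition next_chord :: "nat \<Rightarrow> nat" where
  "next_chord e = 8 * (e div 8) + (e + 1) mod 8"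

definition tile_cross :: "nat \<Rightarrow> nat \<Rightarrow> bool" where
  "tile_cross e f \<longleftrightarrow> 8 \<le> e \<and> 8 \<le> f \<and> (f = next_chord e \<or> e = next_chord f)"

text \<open>The crossing of the diagonal \<open>e\<close> with \<open>next_chord e\<close>.\<close>

definition chord_crossing :: "nat \<Rightarrow> int \<times> int" where
  "chord_crossing e =
     [(90, 96), (126, 48), (138, 0), (126, -48), (90, -96), (70, -112), (42, 0), (70, 112),
      (100, 96), (136, 48), (148, 0), (136, -48), (100, -96), (85, -114), (332, 0), (85, 114)]
     ! (e - 8)"

definition chord_color :: "nat \<Rightarrow> nat" where
  "chord_color e = (if e mod 8 \<in> {0, 1, 4, 5} then 1 else 2)"

definition halves :: "nat \<Rightarrow> ((int \<times> int) \<times> (int \<times> int)) list" where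
  "halves e = [(corner (tail_of e), bend e), (bend e, corner (head_of e))]"

definition orient_int :: "int \<times> int \<Rightarrow> int \<times> int \<Rightarrow> int \<times> int \<Rightarrow> int" where
  "orient_int a b c =
     (fst b - fst a) * (snd c - snd a) - (snd b - snd a) * (fst c - fst a)"

text \<open>The inner product of \<open>x - a\<close> and \<open>b - x\<close>, positive if \<open>x\<close> lies strictly
between \<open>a\<close> and \<open>b\<close> on a line.\<close>

definition dot_int :: "int \<times> int \<Rightarrow> int \<times> int \<Rightarrow> int \<times> int \<Rightarrow> int" where
  "dot_int a x b = (fst x - fst a) * (fst b - fst x) + (snd x - snd a) * (snd b - snd x)"

text \<open>A sufficient condition for the segments \<open>p q\<close> and \<open>r s\<close> to be disjoint: one of them
lies on one side of the line through the other.\<close>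

definition apart_int ::
  "int \<times> int \<Rightarrow> int \<times> int \<Rightarrow> int \<times> int \<Rightarrow> int \<times> int \<Rightarrow> bool" where
  "apart_int p q r s \<longleftrightarrow>
     0 < orient_int p q r * orient_int p q s \<or> 0 < orient_int r s p * orient_int r s q"

text \<open>The lines \<open>p q\<close> and \<open>r s\<close> are not parallel and meet at \<open>x\<close>.\<close>

definition meet_int ::
  "int \<times> int \<Rightarrow> int \<times> int \<Rightarrow> int \<times> int \<Rightarrow> int \<times> int \<Rightarrow> int \<times> int \<Rightarrow> bool" where
  "meet_int p q r s x \<longleftrightarrow> orient_int p q x = 0 \<and> orient_int r s x = 0 \<and>
      orient_int p q r \<noteq> orient_int p q s"

text \<open>The common ends, and the crossing if there is one. Distinct edges share no other points; this is
\<open>tile_edges_meet\<close>.\<close>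

definition common_points :: "nat \<Rightarrow> nat \<Rightarrow> (int \<times> int) list" where
  "common_points e f =
     map corner (filter (\<lambda>i. i = tail_of f \<or> i = head_of f) [tail_of e, head_of e])
     @ (if 8 \<le> e \<and> f = next_chord e then [chord_crossing e] else [])
     @ (if 8 \<le> f \<and> e = next_chord f then [chord_crossing f] else [])"

definition meet_only_at :: "(int \<times> int) list \<Rightarrow> ((int \<times> int) \<times> (int \<times> int)) list \<Rightarrow>
    ((int \<times> int) \<times> (int \<times> int)) list \<Rightarrow> bool" where
  "meet_only_at xs ss ts \<longleftrightarrow>
     list_all (\<lambda>(p, q). list_all (\<lambda>(r, s).
       apart_int p q r s \<or> list_ex (meet_int p q r s) xs) ts) ss"

lemma list_all_upt: "list_all P [m..<n] \<longleftrightarrow> (\<forall>i. m \<le> i \<and> i < n \<longrightarrow> P i)"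
  unfolding list_all_iff set_upt by auto

lemma list_ex_upt: "list_ex P [m..<n] \<longleftrightarrow> (\<exists>i. m \<le> i \<and> i < n \<and> P i)"
  unfolding list_ex_iff set_upt by auto

text \<open>The barycentric coordinates of \<open>z\<close> in the triangle \<open>a b c\<close>, multiplied by the square of
its doubled area.\<close>

definition bary_int :: "int \<times> int \<Rightarrow> int \<times> int \<Rightarrow> int \<times> int \<Rightarrow> int \<times> int \<Rightarrow> int list" where
  "bary_int a b c z =
     [orient_int a b z * orient_int a b c, orient_int b c z * orient_int a b c,
      orient_int c a z * orient_int a b c]"

lemma tile_cross_ge: "tile_cross e f \<Longrightarrow> 8 \<le> e \<and> 8 \<le> f"
  by (simp add: tile_cross_def)

lemma next_chord_ge: "8 \<le> e \<Longrightarrow> 8 \<le> next_chord e"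
  using div_le_mono[of 8 e 8] unfolding next_chord_def by simp

definition crossers :: "nat \<Rightarrow> nat list" where
  "crossers e = filter (tile_cross e) [0..<24]"

section \<open>Properties of the tile found by calculation\<close>

text \<open>Each pair of halves of two edges is separated by a line or spans lines that meet in one of the
listed points; thus the edges have no other common points.\<close>

lemma tile_meetings_check:
  "list_all (\<lambda>f. list_all (\<lambda>e. meet_only_at (common_points e f) (halves e) (halves f)) [0..<f])
    [0..<24]"
  by code_simp

lemma tile_bends_check:
  "list_all (\<lambda>e. tail_of e \<noteq> head_of e \<and>
     (orient_int (corner (tail_of e)) (bend e) (corner (head_of e)) \<noteq> 0 \<or>
      0 < dot_int (corner (tail_of e)) (bend e) (corner (head_of e)))) [0..<24]"
  by code_simp

lemma tile_corners_check:
  "list_all (\<lambda>i. list_all (\<lambda>e. i = tail_of e \<or> i = head_of e \<or>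
     list_all (\<lambda>(p, q). orient_int p q (corner i) \<noteq> 0 \<or> dot_int p (corner i) q < 0) (halves e))
     [0..<24]) [0..<8]"
  by code_simp

text \<open>The listed crossings lie strictly inside a half of both edges, and these halves have different
directions; so the edges really cross there and do not touch.\<close>

lemma tile_crossings_check:
  "list_all (\<lambda>e. list_ex (\<lambda>(p, q). list_ex (\<lambda>(r, s).
       orient_int p q (chord_crossing e) = 0 \<and> 0 < dot_int p (chord_crossing e) q \<and>
       orient_int r s (chord_crossing e) = 0 \<and> 0 < dot_int r (chord_crossing e) s \<and>
       orient_int p q r \<noteq> orient_int p q s)
     (halves (next_chord e))) (halves e)) [8..<24]"
  by code_simp

text \<open>The lune is the region \<open>(168 - \<bar>y\<bar>) / 7 \<le> x \<le> 3 (168 - \<bar>y\<bar>)\<close>. The second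
inequality describes a convex set, for which the ends of a segment suffice. The first one describes
the union of two half-planes, and both ends have to lie in the same one.\<close>

lemma tile_lune_check:
  "list_all (\<lambda>e. list_all (\<lambda>((x, y), (x', y')).
       x \<le> 3 * (168 - \<bar>y\<bar>) \<and> x' \<le> 3 * (168 - \<bar>y'\<bar>) \<and>
       (168 - y \<le> 7 * x \<and> 168 - y' \<le> 7 * x' \<or> 168 + y \<le> 7 * x \<and> 168 + y' \<le> 7 * x')) (halves e))
     [0..<24]"
  by code_simp

lemma tile_parallel_check:
  "list_all (\<lambda>f. list_all (\<lambda>e.
      {tail_of e, head_of e} = {tail_of f, head_of f} \<longrightarrow> 8 \<le> e \<and> f = e + 8) [0..<f]) [0..<24]"
  by code_simp

lemma tile_pole_edge_check:
  "list_all (\<lambda>e. {tail_of e, head_of e} = {0, 7} \<longrightarrow> e = 7) [0..<24]"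
  by code_simp

lemma tile_chords_straight_check:
  "list_all (\<lambda>e. 2 * fst (bend e) = fst (corner (tail_of e)) + fst (corner (head_of e)) \<and>
      2 * snd (bend e) = snd (corner (tail_of e)) + snd (corner (head_of e))) [8..<16]"
  by code_simp

text \<open>The points needed on the two sides of a lens within the tile: a corner with positive barycentric
coordinates lies inside the triangle, one with a negative coordinate outside.\<close>

lemma tile_lens_check:
  "list_all (\<lambda>e. list_ex (\<lambda>i. list_all (\<lambda>x. 0 < x)
         (bary_int (corner (tail_of e)) (bend (e + 8)) (corner (head_of e)) (corner i))) [0..<8] \<and>
       list_ex (\<lambda>i. list_ex (\<lambda>x. x < 0)
         (bary_int (corner (tail_of e)) (bend (e + 8)) (corner (head_of e)) (corner i))) [0..<8])
     [8..<16]"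
  by code_simp

lemma tile_corners_distinct: "distinct (map corner [0..<8])"
  by code_simp

lemma tile_crossings_distinct: "distinct (map chord_crossing [8..<24])"
  by code_simp

lemma tile_not_adjacent_check:
  "list_all (\<lambda>e. {tail_of e, head_of e} \<inter> {tail_of (next_chord e), head_of (next_chord e)} = {} \<and>
    8 \<le> next_chord e \<and> next_chord e < 24 \<and> next_chord e \<noteq> e \<and> next_chord (next_chord e) \<noteq> e)
    [8..<24]"
  by code_simp

lemma tile_coloring_check:
  "list_all (\<lambda>e. distinct (map chord_color (crossers e))) [0..<24]"
  by code_simp

text \<open>The crossing partners of an edge do not cross each other, so no three edges have a common crossing.\<close>

lemma tile_triangle_check:
  "list_all (\<lambda>e. list_all (\<lambda>f. \<not> list_ex (tile_cross f) (crossers e)) (crossers e)) [0..<24]"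
  by code_simp

lemma set_crossers: "f \<in> set (crossers e) \<longleftrightarrow> f < 24 \<and> tile_cross e f"
  unfolding crossers_def set_filter set_upt by auto

lemma chord_color_inj:
  assumes "e < 24" "f < 24" "f' < 24" "tile_cross e f" "tile_cross e f'"
    and "chord_color f = chord_color f'"
  shows "f = f'"
proof -
  have "distinct (map chord_color (crossers e))"
    using tile_coloring_check[unfolded list_all_upt, rule_format, OF conjI[OF le0 assms(1)]] .
  then have "inj_on chord_color (set (crossers e))" by (simp only: distinct_map)
  then show ?thesis using assms by (auto simp: set_crossers dest: inj_onD)
qed

lemma tile_cross_triangle_free:
  assumes "e < 24" "f < 24" "g < 24" "tile_cross e f" "tile_cross e g"
  shows "\<not> tile_cross f g"
proof -
  have "list_all (\<lambda>f. \<not> list_ex (tile_cross f) (crossers e)) (crossers e)"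
    using tile_triangle_check[unfolded list_all_upt, rule_format, OF conjI[OF le0 assms(1)]] .
  moreover have "f \<in> set (crossers e)" "g \<in> set (crossers e)"
    using assms by (simp_all add: set_crossers)
  ultimately show ?thesis unfolding list_all_iff list_ex_iff by blast
qed

section \<open>The tile in the plane\<close>

definition pt :: "int \<times> int \<Rightarrow> complex" where
  "pt p = Complex (of_int (fst p)) (of_int (snd p))"

lemma orient_pt: "orient (pt a) (pt b) (pt c) = of_int (orient_int a b c)"
  by (simp add: orient_def orient_int_def pt_def)

lemma inner_pt: "(pt x - pt a) \<bullet> (pt b - pt x) = of_int (dot_int a x b)"
  by (simp add: dot_int_def pt_def inner_complex_def)

lemma pt_eq_iff [simp]: "pt a = pt b \<longleftrightarrow> a = b"
  by (auto simp: pt_def prod_eq_iff)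

abbreviation "corner_pt i \<equiv> pt (corner i)"

definition tile_edge :: "nat \<Rightarrow> real \<Rightarrow> complex" where
  "tile_edge e = bent_path (corner_pt (tail_of e)) (pt (bend e)) (corner_pt (head_of e))"

lemma ends_tile_edge [simp]:
  "pathstart (tile_edge e) = corner_pt (tail_of e)"
    "pathfinish (tile_edge e) = corner_pt (head_of e)"
  by (simp_all add: tile_edge_def)

lemma path_image_tile_edge:
  "path_image (tile_edge e) = (\<Union>(p, q)\<in>set (halves e). closed_segment (pt p) (pt q))"
  by (simp add: tile_edge_def path_image_bent_path halves_def)

lemma tail_head_less: "tail_of e < 8" "head_of e < 8"
  by (simp_all add: tail_of_def head_of_def)

lemma tile_edge_bend:
  assumes "e < 24"
  shows "orient (corner_pt (tail_of e)) (pt (bend e)) (corner_pt (head_of e)) \<noteq> 0 \<or>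
     (corner_pt (tail_of e) - pt (bend e)) \<bullet> (corner_pt (head_of e) - pt (bend e)) < 0"
proof -
  have "(corner_pt (tail_of e) - pt (bend e)) \<bullet> (corner_pt (head_of e) - pt (bend e)) =
    - of_int (dot_int (corner (tail_of e)) (bend e) (corner (head_of e)))"
    unfolding inner_pt[symmetric] by (simp add: inner_complex_def algebra_simps)
  then show ?thesis
  using tile_bends_check[unfolded list_all_upt] assms unfolding list_all_iff orient_pt by auto
qed

lemma arc_tile_edge: "e < 24 \<Longrightarrow> arc (tile_edge e)"
  unfolding tile_edge_def by (intro arc_bent_path tile_edge_bend)

lemma tail_neq_head: "e < 24 \<Longrightarrow> tail_of e \<noteq> head_of e"
  using tile_bends_check[unfolded list_all_upt] by (auto simp: list_all_iff)

lemma corner_eq_iff: "i < 8 \<Longrightarrow> j < 8 \<Longrightarrow> corner i = corner j \<longleftrightarrow> i = j"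
  using tile_corners_distinct by (auto simp: distinct_map inj_on_def simp del: upt_rec_numeral)

lemma common_points_commute: "set (common_points e f) = set (common_points f e)"
  by (auto simp: common_points_def)

text \<open>The calculation with integers transfers to the plane because \<open>pt\<close> preserves orientations.\<close>

lemma tile_edges_meet_lt:
  assumes "e < f" "f < 24"
  shows "path_image (tile_edge e) \<inter> path_image (tile_edge f) \<subseteq> pt ` set (common_points e f)"
proof
  fix z assume "z \<in> path_image (tile_edge e) \<inter> path_image (tile_edge f)"
  then obtain p q r s where h: "(p, q) \<in> set (halves e)" "(r, s) \<in> set (halves f)"
    and z: "z \<in> closed_segment (pt p) (pt q)" "z \<in> closed_segment (pt r) (pt s)"
    by (auto simp: path_image_tile_edge)
  have "meet_only_at (common_points e f) (halves e) (halves f)"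
    using tile_meetings_check[unfolded list_all_upt] assms by (auto simp: list_all_iff)
  then have "apart_int p q r s \<or> (\<exists>x\<in>set (common_points e f). meet_int p q r s x)"
    using h unfolding meet_only_at_def list_all_iff list_ex_iff by fast
  then show "z \<in> pt ` set (common_points e f)"
  proof
    assume "apart_int p q r s"
    then have "0 < orient (pt p) (pt q) (pt r) * orient (pt p) (pt q) (pt s) \<or>
      0 < orient (pt r) (pt s) (pt p) * orient (pt r) (pt s) (pt q)"
      unfolding apart_int_def orient_pt of_int_mult[symmetric] of_int_0_less_iff .
    then show ?thesis using segments_apart z by blast
  next
    assume "\<exists>x\<in>set (common_points e f). meet_int p q r s x"
    then obtain x where x: "x \<in> set (common_points e f)" "meet_int p q r s x" by blast
    then have "closed_segment (pt p) (pt q) \<inter> closed_segment (pt r) (pt s) \<subseteq> {pt x}"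
      by (intro segments_meet_once) (simp_all add: meet_int_def orient_pt)
    then show ?thesis using z x by blast
  qed
qed

lemma tile_edges_meet:
  assumes "e < 24" "f < 24" "e \<noteq> f"
  shows "path_image (tile_edge e) \<inter> path_image (tile_edge f) \<subseteq> pt ` set (common_points e f)"
proof (cases "e < f")
  case True
  then show ?thesis using tile_edges_meet_lt assms by simp
next
  case False
  then show ?thesis using tile_edges_meet_lt[of f e] common_points_commute assms by auto
qed

lemma corner_not_interior:
  assumes "e < 24" "i < 8"
  shows "corner_pt i \<notin> arc_interior (tile_edge e)"
proof
  assume a: "corner_pt i \<in> arc_interior (tile_edge e)"
  then have ne: "i \<noteq> tail_of e" "i \<noteq> head_of e" by (auto simp: arc_interior_def)
  obtain p q where pq: "(p, q) \<in> set (halves e)"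
    and on: "corner_pt i \<in> closed_segment (pt p) (pt q)"
    using a by (auto simp: arc_interior_def path_image_tile_edge)
  have *: "orient_int p q (corner i) \<noteq> 0 \<or> dot_int p (corner i) q < 0"
    using tile_corners_check[unfolded list_all_upt] assms ne pq unfolding list_all_iff by fastforce
  have "orient_int p q (corner i) = 0"
    using orient_on_segment[OF on] by (simp add: orient_pt)
  moreover have "0 \<le> (corner_pt i - pt p) \<bullet> (pt q - corner_pt i)"
  proof -
    obtain u where u: "0 \<le> u" "u \<le> 1" "corner_pt i = (1 - u) *\<^sub>R pt p + u *\<^sub>R pt q"
      using on by (auto simp: in_segment)
    have "corner_pt i - pt p = u *\<^sub>R (pt q - pt p)" "pt q - corner_pt i = (1 - u) *\<^sub>R (pt q - pt p)"
      unfolding u(3) by (simp_all add: algebra_simps)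
    then show ?thesis using u by simp
  qed
  ultimately show False using * by (simp add: inner_pt)
qed

text \<open>The crossing lies strictly inside one half of each of the two edges, hence not on the other half,
which touches the first one only at the bend.\<close>

lemma chord_crossing_straight:
  assumes "8 \<le> e" "e < 24"
  obtains p q p' q' r s r' s' where
    "path_image (tile_edge e) = closed_segment (pt p) (pt q) \<union> closed_segment (pt p') (pt q')"
    "pt (chord_crossing e) \<in> open_segment (pt p) (pt q)"
    "pt (chord_crossing e) \<notin> closed_segment (pt p') (pt q')"
    "path_image (tile_edge (next_chord e)) =
       closed_segment (pt r) (pt s) \<union> closed_segment (pt r') (pt s')"
    "pt (chord_crossing e) \<in> open_segment (pt r) (pt s)"
    "pt (chord_crossing e) \<notin> closed_segment (pt r') (pt s')"
    "orient (pt p) (pt q) (pt r) \<noteq> orient (pt p) (pt q) (pt s)"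
proof -
  let ?x = "chord_crossing e"
  have n: "next_chord e < 24" using tile_not_adjacent_check[unfolded list_all_upt] assms
    by (auto simp: list_all_iff)
  have split: "\<exists>p' q'. path_image (tile_edge f) =
      closed_segment (pt p) (pt q) \<union> closed_segment (pt p') (pt q') \<and>
      pt ?x \<in> open_segment (pt p) (pt q) \<and> pt ?x \<notin> closed_segment (pt p') (pt q')"
    if f: "f < 24" "(p, q) \<in> set (halves f)" "orient_int p q ?x = 0" "0 < dot_int p ?x q" for f p q
  proof -
    have o: "pt ?x \<in> open_segment (pt p) (pt q)"
      using f by (intro open_segment_if_orient_zero) (simp_all add: orient_pt inner_pt)
    let ?a = "corner_pt (tail_of f)" and ?b = "pt (bend f)" and ?c = "corner_pt (head_of f)"
    have im: "path_image (tile_edge f) = closed_segment ?a ?b \<union> closed_segment ?b ?c"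
      by (simp add: tile_edge_def path_image_bent_path)
    have *: "closed_segment ?a ?b \<inter> closed_segment ?b ?c \<subseteq> {?b}"
      using segments_at_bend tile_edge_bend f by blast
    have "pt ?x \<noteq> ?b" using o f(2) by (auto simp: halves_def open_segment_def)
    from f(2) consider "p = corner (tail_of f)" "q = bend f" | "p = bend f" "q = corner (head_of f)"
      by (auto simp: halves_def)
    then show ?thesis
    proof cases
      case 1
      then show ?thesis using o im * \<open>pt ?x \<noteq> ?b\<close>
        by (intro exI[of _ "bend f"] exI[of _ "corner (head_of f)"]) (auto simp: open_segment_def)
    next
      case 2
      then show ?thesis using o im * \<open>pt ?x \<noteq> ?b\<close>
        by (intro exI[of _ "corner (tail_of f)"] exI[of _ "bend f"]) (auto simp: open_segment_def)
    qed
  qed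
  obtain p q r s where "(p, q) \<in> set (halves e)" "(r, s) \<in> set (halves (next_chord e))"
     "orient_int p q ?x = 0" "0 < dot_int p ?x q" "orient_int r s ?x = 0" "0 < dot_int r ?x s"
     "orient_int p q r \<noteq> orient_int p q s"
    using tile_crossings_check[unfolded list_all_upt] assms unfolding list_all_iff list_ex_iff
      by fastforce
  with split[of e p q] split[of "next_chord e" r s] assms n that[of p q _ _ r s]
  show ?thesis by (auto simp: orient_pt)
qed

lemma chord_cross_at:
  assumes "8 \<le> e" "e < 24"
  shows "cross_at (pt (chord_crossing e)) (tile_edge e) (tile_edge (next_chord e))"
    and "cross_at (pt (chord_crossing e)) (tile_edge (next_chord e)) (tile_edge e)"
proof -
  obtain p q p' q' r s r' s' where *:
    "path_image (tile_edge e) = closed_segment (pt p) (pt q) \<union> closed_segment (pt p') (pt q')"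
    "pt (chord_crossing e) \<in> open_segment (pt p) (pt q)"
    "pt (chord_crossing e) \<notin> closed_segment (pt p') (pt q')"
    "path_image (tile_edge (next_chord e)) =
       closed_segment (pt r) (pt s) \<union> closed_segment (pt r') (pt s')"
    "pt (chord_crossing e) \<in> open_segment (pt r) (pt s)"
    "pt (chord_crossing e) \<notin> closed_segment (pt r') (pt s')"
    "orient (pt p) (pt q) (pt r) \<noteq> orient (pt p) (pt q) (pt s)"
    using chord_crossing_straight[OF assms] .
  show "cross_at (pt (chord_crossing e)) (tile_edge e) (tile_edge (next_chord e))"
    by (rule cross_at_straight_pieces[OF *(1) _ *(3) *(4) _ *(6,2,5,7)]) auto
  have "orient (pt r) (pt s) (pt p) \<noteq> orient (pt r) (pt s) (pt q)"
    using *(7) crossing_direction_commute[of "pt r" "pt s" "pt p" "pt q"] by simp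
  then show "cross_at (pt (chord_crossing e)) (tile_edge (next_chord e)) (tile_edge e)"
    by (intro cross_at_straight_pieces[OF *(4) _ *(6) *(1) _ *(3,5,2)]) auto
qed

lemma chord_crossing_on_both:
  assumes "8 \<le> e" "e < 24"
  shows "pt (chord_crossing e) \<in> arc_interior (tile_edge e)"
    and "pt (chord_crossing e) \<in> arc_interior (tile_edge (next_chord e))"
proof -
  let ?x = "pt (chord_crossing e)" and ?f = "next_chord e"
  have n: "{tail_of e, head_of e} \<inter> {tail_of ?f, head_of ?f} = {}" "?f < 24" "?f \<noteq> e"
    using tile_not_adjacent_check[unfolded list_all_upt] assms by (auto simp: list_all_iff)
  have on: "?x \<in> path_image (tile_edge e)" "?x \<in> path_image (tile_edge ?f)"
    using chord_crossing_straight[OF assms] by (metis UnI1 open_closed_segment)+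
  \<comment> \<open>An end of one edge on both edges would be a common end of them.\<close>
  have "?x \<noteq> corner_pt i" if "i < 8" for i
    using on n corner_not_interior[OF assms(2) that] corner_not_interior[OF n(2) that] that
      tail_head_less corner_eq_iff
    unfolding arc_interior_def
      by (metis DiffI disjoint_insert(1) insert_iff pt_eq_iff empty_iff ends_tile_edge Int_iff)
  then show "?x \<in> arc_interior (tile_edge e)" "?x \<in> arc_interior (tile_edge ?f)"
    using on tail_head_less by (auto simp: arc_interior_def simp del: pt_eq_iff)
qed

text \<open>A common point is a common end or a listed crossing, and the ends are excluded here.\<close>

lemma tile_interiors_meet:
  assumes "e < 24" "f < 24" "e \<noteq> f" "z \<in> arc_interior (tile_edge e)"
    "z \<in> arc_interior (tile_edge f)"
  shows "8 \<le> e \<and> f = next_chord e \<and> z = pt (chord_crossing e) \<or>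
    8 \<le> f \<and> e = next_chord f \<and> z = pt (chord_crossing f)"
proof -
  have "z \<in> pt ` set (common_points e f)"
    using tile_edges_meet[of e f] assms by (auto simp: arc_interior_def)
  moreover have "z \<noteq> corner_pt (tail_of e)" "z \<noteq> corner_pt (head_of e)"
    using assms(4) by (auto simp: arc_interior_def)
  ultimately show ?thesis by (auto simp: common_points_def split: if_splits)
qed

lemma tile_edge_in_lune: "e < 24 \<Longrightarrow> z \<in> path_image (tile_edge e) \<Longrightarrow>
   168 - \<bar>Im z\<bar> \<le> 7 * Re z \<and> Re z \<le> 3 * (168 - \<bar>Im z\<bar>)"
proof -
  assume e: "e < 24" "z \<in> path_image (tile_edge e)"
  obtain x y x' y' where h: "((x, y), (x', y')) \<in> set (halves e)"
    and z: "z \<in> closed_segment (pt (x, y)) (pt (x', y'))"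
    using e by (auto simp: path_image_tile_edge)
  obtain u where u: "0 \<le> u" "u \<le> 1" "z = (1 - u) *\<^sub>R pt (x, y) + u *\<^sub>R pt (x', y')"
    using z by (auto simp: in_segment)
  have z': "Re z = (1 - u) * x + u * x'" "Im z = (1 - u) * y + u * y'"
    by (simp_all add: u(3) pt_def)
  have conv: "(1 - u) * of_int s + u * of_int t \<le> r" if "s \<le> r'" "t \<le> r'" "of_int r' = r"
    for s t r' :: int and r :: real
    using that u by (metis convex_bound_le of_int_le_iff diff_add_cancel diff_ge_0_iff_ge
      add.commute)
  have "x \<le> 3 * (168 - \<bar>y\<bar>) \<and> x' \<le> 3 * (168 - \<bar>y'\<bar>) \<and>
       (168 - y \<le> 7 * x \<and> 168 - y' \<le> 7 * x' \<or> 168 + y \<le> 7 * x \<and> 168 + y' \<le> 7 * x')"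
    using tile_lune_check[unfolded list_all_upt] h e(1) unfolding list_all_iff by fastforce
  then have b: "x + 3 * y \<le> 504" "x' + 3 * y' \<le> 504" "x - 3 * y \<le> 504" "x' - 3 * y' \<le> 504"
    "- 7 * x - y \<le> - 168 \<and> - 7 * x' - y' \<le> - 168 \<or> - 7 * x + y \<le> - 168 \<and> - 7 * x' + y' \<le> -168"
    by (auto simp: abs_if split: if_splits)
  have "Re z + 3 * Im z \<le> 504" "Re z - 3 * Im z \<le> 504"
    using conv[OF b(1,2)] conv[OF b(3,4)] by (simp_all add: z' algebra_simps)
  moreover have "- 7 * Re z - Im z \<le> - 168 \<or> - 7 * Re z + Im z \<le> - 168"
    using b(5) conv[of "- 7 * x - y" "-168" "- 7 * x' - y'"] conv[of "- 7 * x + y" "-168"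
      "- 7 * x' + y'"]
    by (auto simp add: z' algebra_simps)
  ultimately show ?thesis by (auto simp: abs_if)
qed

text \<open>The inner diagonal is straight and the outer one has one bend, so together they are the boundary
of a triangle.\<close>

lemma two_sided_parallel_tile:
  assumes "8 \<le> e" "e < 16"
  shows "two_sided (path_image (tile_edge e) \<union> path_image (tile_edge (e + 8))) (corner_pt ` {..<8})"
proof -
  define a b c where "a = corner (tail_of e)" and "b = bend (e + 8)" and "c = corner (head_of e)"
  have "(e + 8 + 2) mod 8 = (e + 2) mod 8" by (metis add.assoc add.commute mod_add_self2)
  then have same: "tail_of (e + 8) = tail_of e" "head_of (e + 8) = head_of e"
    using assms by (simp_all only: tail_of_def head_of_def) simp_all
  have "2 * fst (bend e) = fst a + fst c" "2 * snd (bend e) = snd a + snd c"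
    using tile_chords_straight_check[unfolded list_all_upt, rule_format, of e] assms
    unfolding a_def c_def by blast+
  then have "2 * real_of_int (fst (bend e)) = fst a + fst c"
    "2 * real_of_int (snd (bend e)) = snd a + snd c"
    by linarith+
  then have "pt (bend e) = midpoint (pt a) (pt c)"
    by (simp add: midpoint_def pt_def complex_eq_iff)
  then have "path_image (tile_edge e) = closed_segment (pt a) (pt c)"
    using Un_closed_segment[of "pt (bend e)" "pt a" "pt c"]
    by (simp add: tile_edge_def path_image_bent_path a_def c_def)
  then have C: "path_image (tile_edge e) \<union> path_image (tile_edge (e + 8)) =
     closed_segment (pt a) (pt b) \<union> closed_segment (pt b) (pt c) \<union> closed_segment (pt c) (pt a)"
    using same by (auto simp: tile_edge_def path_image_bent_path a_def b_def c_def
      closed_segment_commute)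
  have "\<exists>i<8. list_all (\<lambda>x. 0 < x) (bary_int a b c (corner i))"
    "\<exists>i<8. list_ex (\<lambda>x. x < 0) (bary_int a b c (corner i))"
    using tile_lens_check[unfolded list_all_upt list_ex_upt, rule_format, of e] assms
    unfolding a_def b_def c_def by blast+
  then obtain i i' where i: "i < 8" "list_all (\<lambda>x. 0 < x) (bary_int a b c (corner i))"
     and i': "i' < 8" "list_ex (\<lambda>x. x < 0) (bary_int a b c (corner i'))"
    by blast
  have W: "corner_pt i \<in> corner_pt ` {..<8}" "corner_pt i' \<in> corner_pt ` {..<8}"
    using i(1) i'(1) by (intro imageI; simp)+
  have prod: "orient (pt p) (pt q) (pt r) * orient (pt a) (pt b) (pt c) =
      of_int (orient_int p q r * orient_int a b c)" for p q r
    by (simp add: orient_pt)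
  show ?thesis unfolding C
    by (rule two_sided_triangle[OF W(1) _ _ _ W(2)]; unfold prod of_int_0_less_iff
      of_int_less_0_iff)
       (use i(2) i'(2) in \<open>simp_all add: bary_int_def\<close>)
qed

section \<open>Lunes between the poles\<close>

text \<open>These maps fix both poles and map lunes between the poles to such lunes.\<close>

definition stretch :: "real \<Rightarrow> complex \<Rightarrow> complex" where
  "stretch c z = Complex (c * Re z) (Im z)"

lemma Re_Im_stretch [simp]: "Re (stretch c z) = c * Re z" "Im (stretch c z) = Im z"
  by (simp_all add: stretch_def)

lemma linear_stretch: "linear (stretch c)"
  by (intro linearI) (simp_all add: complex_eq_iff algebra_simps)

lemma inj_stretch: "0 < c \<Longrightarrow> inj (stretch c)"
  by (auto simp: inj_def complex_eq_iff)

lemma homeomorphism_stretch: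
  assumes "0 < c" shows "homeomorphism UNIV UNIV (stretch c) (stretch (1 / c))"
proof -
  have "continuous_on UNIV (stretch c)" for c
    by (intro linear_continuous_on linear_linear[THEN iffD2] linear_stretch)
  moreover have "stretch c (stretch (1 / c) z) = z" "stretch (1 / c) (stretch c z) = z" for z
    using assms by (simp_all add: complex_eq_iff)
  ultimately show ?thesis unfolding homeomorphism_def
    by (metis UNIV_I surj_def)
qed

text \<open>The left and the right boundary differ by the factor \<open>21\<close>, so that scaling by \<open>22\<close>
moves a lune past itself.\<close>

definition lune :: "real \<Rightarrow> complex set" where
  "lune c = {z. c * (168 - \<bar>Im z\<bar>) \<le> 7 * Re z \<and> Re z \<le> 3 * c * (168 - \<bar>Im z\<bar>)}"

lemma stretch_lune: "0 < c \<Longrightarrow> z \<in> lune 1 \<Longrightarrow> stretch c z \<in> lune c"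
  by (auto simp: lune_def mult.assoc mult.left_commute)

lemma lunes_meet:
  assumes "0 < c" "22 * c \<le> d"
  shows "lune c \<inter> lune d \<subseteq> {corner_pt 0, corner_pt 7}"
proof
  fix z assume z: "z \<in> lune c \<inter> lune d"
  define t where "t = 168 - \<bar>Im z\<bar>"
  have *: "c * t \<le> 7 * Re z" "Re z \<le> 3 * (c * t)" "d * t \<le> 7 * Re z"
    using z by (auto simp: lune_def t_def mult.assoc)
  then have "0 \<le> c * t" by linarith
  then have t: "0 \<le> t" using assms(1) by (simp add: zero_le_mult_iff)
  then have "22 * c * t \<le> d * t" using assms(2) by (rule mult_right_mono[rotated])
  then have "c * t \<le> 0" using * by linarith
  then have "t = 0" using t assms(1) by (simp add: mult_le_0_iff)
  then have "Re z = 0" "\<bar>Im z\<bar> = 168" using * by (simp_all add: t_def)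
  then show "z \<in> {corner_pt 0, corner_pt 7}" by (auto simp: pt_def corner_def complex_eq_iff)
qed

section \<open>The graph and its placement\<close>

definition copy :: "nat \<Rightarrow> complex \<Rightarrow> complex" where
  "copy j = stretch (22 ^ j)"

text \<open>Edge \<open>24 j + e\<close> is the edge \<open>e\<close> of copy \<open>j\<close>.\<close>

definition curve :: "nat \<Rightarrow> real \<Rightarrow> complex" where
  "curve k = copy (k div 24) \<circ> tile_edge (k mod 24)"

text \<open>The corners \<open>0\<close> and \<open>7\<close> are the poles, shared by all copies of the tile under the
numbers \<open>0\<close> and \<open>1\<close>; the copy \<open>j\<close> owns the numbers \<open>6 j + 2\<close> to \<open>6 j + 7\<close>.\<close>

definition vertex :: "nat \<Rightarrow> nat \<Rightarrow> nat" where
  "vertex j i = (if i = 0 then 0 else if i = 7 then 1 else 6 * j + i + 1)"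

definition place :: "nat \<Rightarrow> complex" where
  "place v = (if v = 0 then corner_pt 0 else if v = 1 then corner_pt 7
     else copy ((v - 2) div 6) (corner_pt ((v - 2) mod 6 + 1)))"

definition chain_graph :: "nat \<Rightarrow> (nat, nat) multigraph" where
  "chain_graph l = \<lparr>verts = {..<2 + 6 * l}, edges = {..<24 * l},
     ends = (\<lambda>k. vertex (k div 24) ` {tail_of (k mod 24), head_of (k mod 24)})\<rparr>"

lemma chain_graph_simps [simp]:
  "verts (chain_graph l) = {..<2 + 6 * l}" "edges (chain_graph l) = {..<24 * l}"
  "ends (chain_graph l) k = vertex (k div 24) ` {tail_of (k mod 24), head_of (k mod 24)}"
  by (simp_all add: chain_graph_def)

lemma mod24_less [simp]: "k mod 24 < (24::nat)" by simp

lemma inj_copy: "inj (copy j)" unfolding copy_def by (intro inj_stretch) simp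

lemma copy_eq_iff [simp]: "copy j z = copy j z' \<longleftrightarrow> z = z'"
  using inj_copy by (auto simp: inj_eq)

lemma homeomorphism_copy: "homeomorphism UNIV UNIV (copy j) (stretch (1 / 22 ^ j))"
  unfolding copy_def by (intro homeomorphism_stretch) simp

lemma copy_poles [simp]: "copy j (corner_pt 0) = corner_pt 0" "copy j (corner_pt 7) = corner_pt 7"
  by (simp_all add: copy_def stretch_def pt_def corner_def)

lemma path_image_curve: "path_image (curve k) = copy (k div 24) ` path_image (tile_edge (k mod 24))"
  by (simp add: curve_def path_image_compose)

lemma arc_interior_curve: "arc_interior (curve k) =
  copy (k div 24) ` arc_interior (tile_edge (k mod 24))"
  by (simp add: curve_def arc_interior_compose inj_copy)

lemma place_vertex: "i < 8 \<Longrightarrow> place (vertex j i) = copy j (corner_pt i)"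
proof -
  assume i: "i < 8"
  consider "i = 0" | "i = 7" | "1 \<le> i" "i \<le> 6" using i by linarith
  then show ?thesis
  proof cases
    case 3
    then have "6 * j + i + 1 - 2 = 6 * j + (i - 1)" by simp
    moreover have "(6 * j + (i - 1)) div 6 = j" "(6 * j + (i - 1)) mod 6 = i - 1"
      using 3 mod_mult_self4[of 6 j "i - 1"] by simp_all
    ultimately show ?thesis using 3 by (simp add: place_def vertex_def)
  qed (simp_all add: place_def vertex_def)
qed

lemma vertex_cases:
  assumes "v < 2 + 6 * l" "1 \<le> l"
  obtains j i where "j < l" "i < 8" "v = vertex j i"
proof -
  consider "v = 0" | "v = 1" | "2 \<le> v" by linarith
  then show ?thesis
  proof cases
    case 3
    then have "v = vertex ((v - 2) div 6) ((v - 2) mod 6 + 1)"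
      using mod_less_divisor[of 6 "v - 2"] by (auto simp: vertex_def)
    moreover have "(v - 2) div 6 < l" using assms(1) 3 by (simp add: div_less_iff_less_mult)
    ultimately show ?thesis using that[of "(v - 2) div 6" "(v - 2) mod 6 + 1"]
      mod_less_divisor[of 6 "v - 2"] by linarith
  next
    case 1 then show ?thesis using that[of 0 0] assms by (simp add: vertex_def)
  next
    case 2 then show ?thesis using that[of 0 7] assms by (simp add: vertex_def)
  qed
qed

lemma vertex_less: "j < l \<Longrightarrow> i < 8 \<Longrightarrow> vertex j i < 2 + 6 * l"
  by (auto simp: vertex_def)

lemma path_image_curve_lune: "path_image (curve k) \<subseteq> lune (22 ^ (k div 24))"
proof -
  have "path_image (tile_edge (k mod 24)) \<subseteq> lune 1"
    using tile_edge_in_lune[of "k mod 24"] by (auto simp: lune_def)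
  then show ?thesis using stretch_lune[of "22 ^ (k div 24)"]
    unfolding path_image_curve copy_def by auto
qed

lemma lunes_of_copies_meet:
  assumes "j \<noteq> j'" shows "lune (22 ^ j) \<inter> lune (22 ^ j') \<subseteq> {corner_pt 0, corner_pt 7}"
proof -
  have *: "lune (22 ^ i) \<inter> lune (22 ^ i') \<subseteq> {corner_pt 0, corner_pt 7}" if "i < i'" for i i'
  proof (rule lunes_meet)
    have "(22::real) ^ Suc i \<le> 22 ^ i'" using that by (intro power_increasing) auto
    then show "22 * 22 ^ i \<le> (22::real) ^ i'" by simp
  qed simp
  show ?thesis using *[of j j'] *[of j' j] assms by (cases "j < j'") auto
qed

lemma corner_in_lune: "i < 8 \<Longrightarrow> copy j (corner_pt i) \<in> lune (22 ^ j)"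
proof -
  assume i: "i < 8"
  then have "tail_of i = i" by (simp add: tail_of_def)
  then have "corner_pt i \<in> path_image (tile_edge i)"
    by (metis ends_tile_edge(1) pathstart_in_path_image)
  then show ?thesis using path_image_curve_lune[of "24 * j + i"] i unfolding path_image_curve
    by auto
qed

lemma copy_eq_poleD:
  assumes "copy j z \<in> {corner_pt 0, corner_pt 7}" shows "z \<in> {corner_pt 0, corner_pt 7}"
  using assms by (metis copy_eq_iff copy_poles insert_iff singletonD)

text \<open>Points of different copies can only coincide at the poles, where the lunes meet.\<close>

lemma place_vertex_eqD:
  assumes "i < 8" "i' < 8" "copy j (corner_pt i) = copy j' (corner_pt i')"
  shows "i = i' \<and> (j = j' \<or> i \<in> {0, 7})"
proof (cases "j = j'")
  case True
  then show ?thesis using assms by (simp add: corner_eq_iff)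
next
  case False
  then have "copy j (corner_pt i) \<in> {corner_pt 0, corner_pt 7}"
    "copy j' (corner_pt i') \<in> {corner_pt 0, corner_pt 7}"
    using lunes_of_copies_meet[OF False] corner_in_lune[of i j] corner_in_lune[of i' j'] assms
      by auto
  then have "i \<in> {0, 7}" "i' \<in> {0, 7}" "copy j (corner_pt i) = corner_pt i"
    "copy j' (corner_pt i') = corner_pt i'"
    using copy_eq_poleD[of j "corner_pt i"] copy_eq_poleD[of j' "corner_pt i'"] assms(1,2)
    by (auto simp: corner_eq_iff)
  then show ?thesis using assms by (simp add: corner_eq_iff)
qed

lemma vertex_eq_iff:
  assumes "i < 8" "i' < 8"
  shows "vertex j i = vertex j' i' \<longleftrightarrow> i = i' \<and> (j = j' \<or> i \<in> {0, 7})"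
proof
  assume "vertex j i = vertex j' i'"
  then have "place (vertex j i) = place (vertex j' i')" by simp
  then show "i = i' \<and> (j = j' \<or> i \<in> {0, 7})"
    using assms by (intro place_vertex_eqD) (simp_all add: place_vertex)
qed (auto simp: vertex_def)

lemma inj_place: "1 \<le> l \<Longrightarrow> inj_on place {..<2 + 6 * l}"
proof (rule inj_onI)
  fix v w assume l: "1 \<le> l" and "v \<in> {..<2 + 6 * l}" "w \<in> {..<2 + 6 * l}"
    and eq: "place v = place w"
  then obtain j i j' i' where v: "i < 8" "v = vertex j i" and w: "i' < 8" "w = vertex j' i'"
    by (metis lessThan_iff vertex_cases)
  then have "copy j (corner_pt i) = copy j' (corner_pt i')" using eq by (simp add: place_vertex)
  then show "v = w" using place_vertex_eqD v w vertex_eq_iff by blast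
qed

lemma pole_not_interior: "corner_pt 0 \<notin> arc_interior (curve k)"
  "corner_pt 7 \<notin> arc_interior (curve k)"
proof -
  have "copy (k div 24) (corner_pt i) \<notin> arc_interior (curve k)" if "i < 8" for i
    using corner_not_interior[of "k mod 24" i] that
      by (auto simp: arc_interior_curve simp del: copy_poles)
  from this[of 0] this[of 7] show "corner_pt 0 \<notin> arc_interior (curve k)"
    "corner_pt 7 \<notin> arc_interior (curve k)"
    by simp_all
qed

text \<open>This separates the copies: two edges from different copies share at most the poles, which are
vertices, so they never cross.\<close>

lemma curves_meet_copies:
  assumes "k div 24 \<noteq> k' div 24"
  shows "path_image (curve k) \<inter> path_image (curve k') \<subseteq> {corner_pt 0, corner_pt 7}"
  using path_image_curve_lune[of k] path_image_curve_lune[of k'] lunes_of_copies_meet[OF assms]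
    by blast

lemma ends_curve: "{pathstart (curve k), pathfinish (curve k)} = place ` ends (chain_graph l) k"
  by (simp add: curve_def pathstart_compose pathfinish_compose place_vertex tail_head_less)

lemma arc_curve: "arc (curve k)"
proof -
  have "arc (tile_edge (k mod 24))" by (simp add: arc_tile_edge)
  then show ?thesis unfolding curve_def copy_def
    by (subst arc_linear_image_eq) (simp_all add: linear_stretch inj_stretch)
qed

section \<open>The drawing\<close>

text \<open>All crossings take place within one copy, at the images of the crossings of the tile.\<close>

lemma curve_interiors_meet:
  assumes "k \<noteq> k'" "z \<in> arc_interior (curve k)" "z \<in> arc_interior (curve k')"
  shows "k div 24 = k' div 24 \<and> tile_cross (k mod 24) (k' mod 24) \<and>
    (z = copy (k div 24) (pt (chord_crossing (k mod 24))) \<and> k' mod 24 = next_chord (k mod 24) \<or>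
     z = copy (k div 24) (pt (chord_crossing (k' mod 24))) \<and> k mod 24 = next_chord (k' mod 24))"
proof -
  have same: "k div 24 = k' div 24"
    using curves_meet_copies[of k k'] assms pole_not_interior[of k] arc_interior_subset by blast
  then have ne: "k mod 24 \<noteq> k' mod 24" using assms(1) by (metis div_mult_mod_eq)
  obtain y where y: "z = copy (k div 24) y" "y \<in> arc_interior (tile_edge (k mod 24))"
      "y \<in> arc_interior (tile_edge (k' mod 24))"
    using assms(2,3) same by (auto simp: arc_interior_curve)
  from tile_interiors_meet[OF _ _ ne y(2,3)] show ?thesis
    using y(1) same next_chord_ge[of "k mod 24"] next_chord_ge[of "k' mod 24"]
    unfolding tile_cross_def by simp metis
qed

lemma tile_cross_not_adjacent:
  assumes "tile_cross e f" "e < 24" "f < 24"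
  shows "{tail_of e, head_of e} \<inter> {tail_of f, head_of f} = {}"
  using assms tile_not_adjacent_check[unfolded list_all_upt] unfolding tile_cross_def by blast

section \<open>Colors and crossings\<close>

lemma edges_cross_curve_iff:
  "edges_cross curve k k' \<longleftrightarrow> k div 24 = k' div 24 \<and> tile_cross (k mod 24) (k' mod 24)"
proof
  assume "edges_cross curve k k'"
  then show "k div 24 = k' div 24 \<and> tile_cross (k mod 24) (k' mod 24)"
    unfolding edges_cross_def using curve_interiors_meet by blast
next
  assume *: "k div 24 = k' div 24 \<and> tile_cross (k mod 24) (k' mod 24)"
  have "8 \<le> k mod 24" "8 \<le> k' mod 24" using * tile_cross_ge by blast+
  then obtain y where "y \<in> arc_interior (tile_edge (k mod 24))"
    "y \<in> arc_interior (tile_edge (k' mod 24))"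
    using * chord_crossing_on_both[of "k mod 24"] chord_crossing_on_both[of "k' mod 24"]
    unfolding tile_cross_def by (metis mod24_less)
  then have "arc_interior (curve k) \<inter> arc_interior (curve k') \<noteq> {}"
    using * by (auto simp: arc_interior_curve)
  moreover have "k \<noteq> k'"
    using * tile_not_adjacent_check[unfolded list_all_upt] \<open>8 \<le> k mod 24\<close>
    unfolding tile_cross_def by (metis mod24_less)
  ultimately show "edges_cross curve k k'" by (simp add: edges_cross_def)
qed

lemma wf_chain_graph: "wf_multigraph (chain_graph l)"
proof -
  have "ends (chain_graph l) k \<subseteq> verts (chain_graph l) \<and> card (ends (chain_graph l) k) = 2"
    if "k < 24 * l" for k
  proof -
    have "k div 24 < l" using that by (simp add: div_less_iff_less_mult mult.commute)
    then show ?thesis using tail_neq_head[of "k mod 24"] vertex_less tail_head_less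
      by (auto simp: vertex_eq_iff)
  qed
  then show ?thesis by (auto simp: wf_multigraph_def simp del: chain_graph_simps(3))
qed

lemma vertices_off_curves:
  assumes "1 \<le> l"
  shows "arc_interior (curve k) \<inter> place ` {..<2 + 6 * l} = {}"
proof -
  have False if z: "z \<in> arc_interior (curve k)" and v: "z = place v" "v < 2 + 6 * l" for z v
  proof -
    obtain j i where ji: "i < 8" "z = copy j (corner_pt i)"
      using vertex_cases[OF v(2) assms] v(1) place_vertex by metis
    show False
    proof (cases "j = k div 24")
      case True
      then show False using z ji corner_not_interior[of "k mod 24" i]
        by (auto simp: arc_interior_curve)
    next
      case False
      have "z \<in> lune (22 ^ j)" "z \<in> lune (22 ^ (k div 24))"
        using ji corner_in_lune z path_image_curve_lune arc_interior_subset by blast+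
      then show False using lunes_of_copies_meet[OF False] z pole_not_interior by blast
    qed
  qed
  then show ?thesis by auto
qed

lemma curves_cross_at:
  assumes kk: "k \<noteq> k'" and z: "z \<in> arc_interior (curve k)" "z \<in> arc_interior (curve k')"
  shows "cross_at z (curve k) (curve k')"
proof -
  define j e f where "j = k div 24" and "e = k mod 24" and "f = k' mod 24"
  have less: "e < 24" "f < 24" by (simp_all add: e_def f_def)
  have c: "k' div 24 = j" "8 \<le> e" "8 \<le> f"
    "z = copy j (pt (chord_crossing e)) \<and> f = next_chord e \<or>
     z = copy j (pt (chord_crossing f)) \<and> e = next_chord f"
    using curve_interiors_meet[OF kk z] tile_cross_ge unfolding j_def e_def f_def by metis+
  have "cross_at z (copy j \<circ> tile_edge e) (copy j \<circ> tile_edge f)"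
    using c(4) cross_at_image[OF homeomorphism_copy chord_cross_at(1)[OF c(2) less(1)], of j]
      cross_at_image[OF homeomorphism_copy chord_cross_at(2)[OF c(3) less(2)], of j] by auto
  then show ?thesis by (simp add: curve_def j_def e_def f_def c(1)[unfolded j_def])
qed

lemma finite_curves_meet:
  assumes kk: "k \<noteq> k'"
  shows "finite (path_image (curve k) \<inter> path_image (curve k'))"
proof -
  let ?A = "{pathstart (curve k), pathfinish (curve k), pathstart (curve k'), pathfinish (curve
    k')}"
  let ?B = "{copy (k div 24) (pt (chord_crossing (k mod 24))),
    copy (k div 24) (pt (chord_crossing (k' mod 24)))}"
  have "arc_interior (curve k) \<inter> arc_interior (curve k') \<subseteq> ?B"
    using curve_interiors_meet[OF kk] by auto
  then have "path_image (curve k) \<inter> path_image (curve k') \<subseteq> ?A \<union> ?B"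
    unfolding arc_interior_def by auto
  then show ?thesis by (rule finite_subset) simp
qed

lemma adjacent_curves_disjoint:
  assumes "k \<noteq> k'" "ends (chain_graph l) k \<inter> ends (chain_graph l) k' \<noteq> {}"
  shows "arc_interior (curve k) \<inter> arc_interior (curve k') = {}"
proof -
  have False if z: "z \<in> arc_interior (curve k)" "z \<in> arc_interior (curve k')" for z
  proof -
    have "k div 24 = k' div 24" "tile_cross (k mod 24) (k' mod 24)"
      using curve_interiors_meet[OF assms(1) z] by auto
    then show False
      using assms(2) tile_cross_not_adjacent[of "k mod 24" "k' mod 24"] tail_head_less
      by (auto simp: vertex_eq_iff)
  qed
  then show ?thesis by blast
qed

lemma three_curves_disjoint:
  assumes "k \<noteq> k'" "k \<noteq> k''" "k' \<noteq> k''"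
  shows "arc_interior (curve k) \<inter> arc_interior (curve k') \<inter> arc_interior (curve k'') = {}"
proof -
  have "\<not> (tile_cross (k mod 24) (k' mod 24) \<and> tile_cross (k mod 24) (k'' mod 24) \<and>
      tile_cross (k' mod 24) (k'' mod 24))"
    using tile_cross_triangle_free[OF mod24_less mod24_less mod24_less, of k k' k''] by blast
  then have False if "z \<in> arc_interior (curve k)" "z \<in> arc_interior (curve k')"
      "z \<in> arc_interior (curve k'')" for z
    using curve_interiors_meet[of k k' z] curve_interiors_meet[of k k'' z]
      curve_interiors_meet[of k' k'' z] that assms by simp
  then show ?thesis by blast
qed

lemma drawing_chain_graph:
  assumes "1 \<le> l"
  shows "is_drawing (chain_graph l) place curve"
  unfolding is_drawing_def
  using inj_place[OF assms] arc_curve ends_curve[of _ l] vertices_off_curves[OF assms]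
    finite_curves_meet curves_cross_at adjacent_curves_disjoint[of _ _ l] three_curves_disjoint
  by (simp del: chain_graph_simps(3))

lemma colorable_chain_graph: "colorable_plane 2 1 (chain_graph l) curve"
proof -
  have "card {f \<in> {..<24 * l}. chord_color (f mod 24) = c \<and> edges_cross curve e f} \<le> 1"
    (is "card ?S \<le> 1") for e c
  proof -
    have "f = f'" if "chord_color (f mod 24) = c" "edges_cross curve e f"
       "chord_color (f' mod 24) = c" "edges_cross curve e f'" for f f'
    proof -
      have cross: "e div 24 = f div 24" "tile_cross (e mod 24) (f mod 24)"
        "e div 24 = f' div 24" "tile_cross (e mod 24) (f' mod 24)"
        using that(2,4) unfolding edges_cross_curve_iff by blast+
      have "f mod 24 = f' mod 24"
        by (rule chord_color_inj[OF mod24_less mod24_less mod24_less cross(2,4)])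
          (simp only: that(1,3))
      moreover have "f div 24 = f' div 24" using cross(1,3) by (rule trans[OF sym])
      ultimately show ?thesis by (metis div_mult_mod_eq)
    qed
    then have "\<forall>f\<in>?S. \<forall>f'\<in>?S. f = f'" by blast
    moreover have "finite ?S" by simp
    ultimately show ?thesis unfolding One_nat_def using card_le_Suc0_iff_eq by blast
  qed
  moreover have "(\<lambda>f. chord_color (f mod 24)) ` edges (chain_graph l) \<subseteq> {1..2}"
    by (auto simp: chord_color_def)
  ultimately show ?thesis unfolding colorable_plane_def chain_graph_simps by blast
qed

lemma crossings_chain_graph:
  "crossings (chain_graph l) curve =
    (\<lambda>(j, e). copy j (pt (chord_crossing e))) ` ({..<l} \<times> {8..<24})"
proof (intro equalityI subsetI)
  fix z assume "z \<in> crossings (chain_graph l) curve"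
  then obtain k k' where k: "k < 24 * l" "k' < 24 * l" "k \<noteq> k'"
     "z \<in> arc_interior (curve k)" "z \<in> arc_interior (curve k')"
    by (auto simp: crossings_def)
  have "k div 24 < l" using k(1) by (simp add: div_less_iff_less_mult mult.commute)
  then show "z \<in> (\<lambda>(j, e). copy j (pt (chord_crossing e))) ` ({..<l} \<times> {8..<24})"
    using curve_interiors_meet[OF k(3-5)] tile_cross_ge[of "k mod 24" "k' mod 24"] by auto
next
  fix z assume "z \<in> (\<lambda>(j, e). copy j (pt (chord_crossing e))) ` ({..<l} \<times> {8..<24})"
  then obtain j e where je: "j < l" "8 \<le> e" "e < 24" "z = copy j (pt (chord_crossing e))" by auto
  let ?f = "next_chord e"
  have f: "?f < 24" "?f \<noteq> e" using tile_not_adjacent_check[unfolded list_all_upt] je by auto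
  have "z \<in> arc_interior (curve (24 * j + e))" "z \<in> arc_interior (curve (24 * j + ?f))"
    using chord_crossing_on_both[OF je(2,3)] je f by (auto simp: arc_interior_curve)
  moreover have "24 * j + e < 24 * l" "24 * j + ?f < 24 * l" "24 * j + e \<noteq> 24 * j + ?f"
    using je f by auto
  ultimately show "z \<in> crossings (chain_graph l) curve"
    unfolding crossings_def chain_graph_simps by blast
qed

lemma card_crossings_chain_graph: "card (crossings (chain_graph l) curve) = 16 * l"
proof -
  have "inj_on (\<lambda>(j, e). copy j (pt (chord_crossing e))) ({..<l} \<times> {8..<24})"
  proof (rule inj_onI, clarify)
    fix j e j' e' assume e: "e \<in> {8..<24}" "e' \<in> {8..<24}"
      and eq: "copy j (pt (chord_crossing e)) = copy j' (pt (chord_crossing e'))"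
    define k k' where "k = 24 * j + e" and "k' = 24 * j' + e'"
    have k: "k div 24 = j" "k mod 24 = e" "k' div 24 = j'" "k' mod 24 = e'"
      using e by (auto simp: k_def k'_def)
    have "copy j (pt (chord_crossing e)) \<in> arc_interior (curve k)"
      using chord_crossing_on_both(1)[of e] e unfolding arc_interior_curve k by simp
    moreover have "copy j' (pt (chord_crossing e')) \<in> arc_interior (curve k')"
      using chord_crossing_on_both(1)[of e'] e unfolding arc_interior_curve k by simp
    ultimately have in_k: "copy j (pt (chord_crossing e)) \<in> arc_interior (curve k)"
      "copy j (pt (chord_crossing e)) \<in> arc_interior (curve k')"
      unfolding eq by blast+
    then have "j = j'" using curve_interiors_meet[of k k'] k by metis
    moreover from this have "chord_crossing e = chord_crossing e'" using eq by simp
    then have "e = e'" using tile_crossings_distinct e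
      by (auto simp: distinct_map inj_on_def simp del: upt_rec_numeral)
    ultimately show "j = j' \<and> e = e'" by simp
  qed
  then show ?thesis unfolding crossings_chain_graph
    by (subst card_image) (simp_all add: card_cartesian_product)
qed

section \<open>Lenses\<close>

text \<open>Edges of different copies share only the poles. Edges of one copy that cross have no common end
and cross once, which leaves only one common point; if they do not cross, they share
only ends.\<close>

lemma common_pair_is_ends:
  assumes "k \<noteq> k'" "p \<noteq> q" "{p, q} \<subseteq> path_image (curve k) \<inter> path_image (curve k')"
  shows "{p, q} = {pathstart (curve k), pathfinish (curve k)}"
proof -
  have "{p, q} \<subseteq> {pathstart (curve k), pathfinish (curve k)}"
  proof (cases "k div 24 = k' div 24")
    case False
    then have "{p, q} \<subseteq> {corner_pt 0, corner_pt 7}" using curves_meet_copies assms(3) by blast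
    then show ?thesis using pole_not_interior[of k] assms(3) unfolding arc_interior_def by blast
  next
    case True
    let ?e = "k mod 24" and ?f = "k' mod 24"
    have ne: "?e \<noteq> ?f" using True assms(1) by (metis div_mult_mod_eq)
    obtain p' q' where p': "p = copy (k div 24) p'" "q = copy (k div 24) q'"
      "{p', q'} \<subseteq> path_image (tile_edge ?e) \<inter> path_image (tile_edge ?f)"
      using assms(3) True by (auto simp: path_image_curve)
    then have pq: "{p', q'} \<subseteq> pt ` set (common_points ?e ?f)" "p' \<noteq> q'"
      using tile_edges_meet[OF _ _ ne] assms(2) by auto
    have "\<not> tile_cross ?e ?f"
    proof
      assume c: "tile_cross ?e ?f"
      then have no: "filter (\<lambda>i. i = tail_of ?f \<or> i = head_of ?f) [tail_of ?e, head_of ?e] = []"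
        using tile_cross_not_adjacent[of ?e ?f] by auto
      have "next_chord (next_chord e) \<noteq> e" if "8 \<le> e" "e < 24" for e
        using tile_not_adjacent_check[unfolded list_all_upt] that by simp
      then have "?e \<noteq> next_chord ?f" if "?f = next_chord ?e"
        using that tile_cross_ge[OF c] by (metis mod24_less)
      then have "set (common_points ?e ?f) \<subseteq> {chord_crossing ?e} \<or>
          set (common_points ?e ?f) \<subseteq> {chord_crossing ?f}"
        unfolding common_points_def no by (cases "?f = next_chord ?e") auto
      then obtain x where "set (common_points ?e ?f) \<subseteq> {x}" by blast
      then have "p' = pt x" "q' = pt x" using pq(1) by blast+
      then show False using pq(2) by simp
    qed
    then have "\<not> (8 \<le> ?e \<and> ?f = next_chord ?e)" "\<not> (8 \<le> ?f \<and> ?e = next_chord ?f)"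
      using next_chord_ge[of ?e] next_chord_ge[of ?f] unfolding tile_cross_def by metis+
    then have "set (common_points ?e ?f) \<subseteq> {corner (tail_of ?e), corner (head_of ?e)}"
      unfolding common_points_def by (simp only: if_False) auto
    then show ?thesis using pq(1) p'(1,2)
      by (auto simp: curve_def pathstart_compose pathfinish_compose)
  qed
  with assms(2) show ?thesis by auto
qed

lemma path_image_pole_edge:
  "path_image (tile_edge 7) = {z. \<bar>Im z\<bar> \<le> 168 \<and> 7 * Re z = 168 - \<bar>Im z\<bar>}"
proof -
  have "path_image (tile_edge 7) = closed_segment (Complex 0 (-168)) (Complex 24 0) \<union>
      closed_segment (Complex 24 0) (Complex 0 168)"
    by (simp add: tile_edge_def path_image_bent_path tail_of_def head_of_def bend_def corner_def
      pt_def)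
  moreover have "closed_segment (Complex 0 (-168)) (Complex 24 0) =
     {z. - 168 \<le> Im z \<and> Im z \<le> 0 \<and> 7 * Re z = 168 + Im z}"
  proof (intro equalityI subsetI)
    fix z assume z: "z \<in> {z. - 168 \<le> Im z \<and> Im z \<le> 0 \<and> 7 * Re z = 168 + Im z}"
    then show "z \<in> closed_segment (Complex 0 (-168)) (Complex 24 0)"
      unfolding in_segment by (intro exI[of _
        "(168 + Im z) / 168"]) (auto simp: complex_eq_iff field_simps)
  qed (auto simp: in_segment)
  moreover have "closed_segment (Complex 24 0) (Complex 0 168) =
     {z. 0 \<le> Im z \<and> Im z \<le> 168 \<and> 7 * Re z = 168 - Im z}"
  proof (intro equalityI subsetI)
    fix z assume z: "z \<in> {z. 0 \<le> Im z \<and> Im z \<le> 168 \<and> 7 * Re z = 168 - Im z}"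
    then show "z \<in> closed_segment (Complex 24 0) (Complex 0 168)"
      unfolding in_segment by (intro exI[of _ "Im z / 168"]) (auto simp: complex_eq_iff field_simps)
  qed (auto simp: in_segment)
  ultimately have "path_image (tile_edge 7) = {z. - 168 \<le> Im z \<and> Im z \<le> 0 \<and> 7 * Re z = 168 + Im z} \<union>
      {z. 0 \<le> Im z \<and> Im z \<le> 168 \<and> 7 * Re z = 168 - Im z}" by (simp only:)
  also have "\<dots> = {z. \<bar>Im z\<bar> \<le> 168 \<and> 7 * Re z = 168 - \<bar>Im z\<bar>}"
  proof (rule set_eqI)
    fix z show "z \<in> {z. - 168 \<le> Im z \<and> Im z \<le> 0 \<and> 7 * Re z = 168 + Im z} \<union>
        {z. 0 \<le> Im z \<and> Im z \<le> 168 \<and> 7 * Re z = 168 - Im z} \<longleftrightarrow>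
      z \<in> {z. \<bar>Im z\<bar> \<le> 168 \<and> 7 * Re z = 168 - \<bar>Im z\<bar>}"
      unfolding Un_iff mem_Collect_eq by linarith
  qed
  finally show ?thesis .
qed

text \<open>The path of copy \<open>j\<close> runs between the two pole edges, that of copy \<open>j'\<close> to the right of
both; corner \<open>3\<close> represents these paths.\<close>

lemma two_sided_pole_edges:
  assumes "j < j'" "j' < l"
  shows "two_sided (path_image (curve (24 * j + 7)) \<union>
    path_image (curve (24 * j' + 7))) (place ` {..<2 + 6 * l})"
proof -
  have im: "path_image (curve (24 * i + 7)) =
    {z. \<bar>Im z\<bar> \<le> 168 \<and> Re z = 22 ^ i / 7 * (168 - \<bar>Im z\<bar>)}" for i
  proof -
    have "path_image (curve (24 * i + 7)) = copy i ` path_image (tile_edge 7)"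
      by (simp add: path_image_curve)
    also have "\<dots> = {z. \<bar>Im z\<bar> \<le> 168 \<and> Re z = 22 ^ i / 7 * (168 - \<bar>Im z\<bar>)}"
    proof (intro equalityI subsetI)
      fix z assume z: "z \<in> {z. \<bar>Im z\<bar> \<le> 168 \<and> Re z = 22 ^ i / 7 * (168 - \<bar>Im z\<bar>)}"
      then have "z = copy i (stretch (1 / 22 ^ i) z)" by (simp add: copy_def complex_eq_iff)
      moreover have "stretch (1 / 22 ^ i) z \<in> path_image (tile_edge 7)"
        using z by (simp add: path_image_pole_edge divide_eq_eq mult.commute)
      ultimately show "z \<in> copy i ` path_image (tile_edge 7)" by blast
    next
      fix z assume "z \<in> copy i ` path_image (tile_edge 7)"
      then obtain w where w: "z = copy i w" "\<bar>Im w\<bar> \<le> 168" "7 * Re w = 168 - \<bar>Im w\<bar>"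
        unfolding path_image_pole_edge by blast
      have "Re z = 22 ^ i / 7 * (7 * Re w)" by (simp add: w(1) copy_def)
      then show "z \<in> {z. \<bar>Im z\<bar> \<le> 168 \<and> Re z = 22 ^ i / 7 * (168 - \<bar>Im z\<bar>)}"
        using w by (simp add: copy_def)
    qed
    finally show ?thesis .
  qed
  define c d where "c = (22::real) ^ j" and "d = (22::real) ^ j'"
  have "22 ^ Suc j \<le> (22::real) ^ j'" using assms by (intro power_increasing) auto
  then have cd: "0 < c" "22 * c \<le> d" by (simp_all add: c_def d_def)
  have v: "copy i (corner_pt 3) \<in> place ` {..<2 + 6 * l}" if "i < l" for i
  proof -
    have "place (vertex i 3) \<in> place ` {..<2 + 6 * l}" using vertex_less[of i l 3] that by simp
    then show ?thesis by (simp add: place_vertex)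
  qed
  have c3: "Re (copy j (corner_pt 3)) = 144 * c" "Re (copy j' (corner_pt 3)) = 144 * d"
      "Im (copy i (corner_pt 3)) = 24" for i
    by (simp_all add: copy_def pt_def corner_def c_def d_def)
  show ?thesis unfolding im c_def[symmetric] d_def[symmetric]
    by (rule two_sided_chevron[of _ _ _ "copy j (corner_pt 3)" _ "copy j' (corner_pt 3)"])
       (use assms cd v in \<open>simp_all add: c3\<close>)
qed

text \<open>Only the poles are shared, so parallel edges of different copies join the poles.\<close>

lemma vertex_image_eqD:
  assumes "A \<subseteq> {..<8}" "B \<subseteq> {..<8}" "vertex j ` A = vertex j' ` B"
  shows "A = B" and "j = j' \<or> A \<subseteq> {0, 7}"
proof -
  have *: "x \<in> B \<and> (j = j' \<or> x \<in> {0, 7})" if x: "x \<in> A" for x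
  proof -
    have "vertex j x \<in> vertex j' ` B" unfolding assms(3)[symmetric] using x by (rule imageI)
    then obtain y where y: "y \<in> B" "vertex j x = vertex j' y" by blast
    have "x < 8" "y < 8" using subsetD[OF assms(1) x] subsetD[OF assms(2) y(1)] by simp_all
    from iffD1[OF vertex_eq_iff[OF this] y(2)] have "x = y" "j = j' \<or> x \<in> {0, 7}" by blast+
    then show ?thesis using y(1) by blast
  qed
  have "y \<in> A" if y: "y \<in> B" for y
  proof -
    have "vertex j' y \<in> vertex j ` A" unfolding assms(3) using y by (rule imageI)
    then obtain x where x: "x \<in> A" "vertex j x = vertex j' y" by auto
    have "x < 8" "y < 8" using subsetD[OF assms(1) x(1)] subsetD[OF assms(2) y] by simp_all
    from iffD1[OF vertex_eq_iff[OF this] x(2)] have "x = y" ..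
    then show ?thesis using x(1) by simp
  qed
  with * show "A = B" by (intro equalityI subsetI) simp_all
  show "j = j' \<or> A \<subseteq> {0, 7}" using * by (cases "j = j'") auto
qed

lemma two_sided_parallel_in_copy:
  assumes "e < f" "f < 24" "j < l" and same: "{tail_of e, head_of e} = {tail_of f, head_of f}"
  shows "two_sided (copy j ` path_image (tile_edge e) \<union> copy j ` path_image (tile_edge f))
    (place ` {..<2 + 6 * l})"
proof -
  have f: "8 \<le> e" "f = e + 8"
    using tile_parallel_check[unfolded list_all_upt, rule_format, OF conjI[OF le0 assms(2)]
      conjI[OF le0 assms(1)] same]
    by (rule conjunct1, rule conjunct2)
  then have "e < 16" using assms(2) by linarith
  have "two_sided (path_image (tile_edge e) \<union> path_image (tile_edge f)) (corner_pt ` {..<8})"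
    unfolding f(2) using f(1) \<open>e < 16\<close> by (rule two_sided_parallel_tile)
  then have "two_sided (copy j ` (path_image (tile_edge e) \<union>
    path_image (tile_edge f))) (copy j ` corner_pt ` {..<8})"
    by (rule two_sided_image[OF homeomorphism_copy])
  moreover have "copy j ` corner_pt ` {..<8} \<subseteq> place ` {..<2 + 6 * l}"
  proof clarify
    fix i :: nat assume i: "i < 8"
    have "place (vertex j i) \<in> place ` {..<2 + 6 * l}"
      using vertex_less[OF assms(3) i] by (intro imageI) (rule lessThan_iff[THEN iffD2])
    then show "copy j (corner_pt i) \<in> place ` {..<2 + 6 * l}" by (simp only: place_vertex[OF i])
  qed
  ultimately show ?thesis unfolding image_Un by (rule two_sided_mono)
qed

lemma two_sided_parallel_curves:
  assumes "k < k'" "k' < 24 * l" and "ends (chain_graph l) k = ends (chain_graph l) k'"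
  shows "two_sided (path_image (curve k) \<union> path_image (curve k')) (place ` {..<2 + 6 * l})"
proof -
  define j e j' f where "j = k div 24" and "e = k mod 24" and "j' = k' div 24" and "f = k' mod 24"
  have k: "k = 24 * j + e" "k' = 24 * j' + f"
    unfolding j_def e_def j'_def f_def by simp_all
  have less: "e < 24" "f < 24" unfolding e_def f_def by simp_all
  have "j' < l" using assms(2) k(2) by linarith
  have eq: "vertex j ` {tail_of e, head_of e} = vertex j' ` {tail_of f, head_of f}"
    using assms(3) unfolding chain_graph_simps j_def e_def j'_def f_def .
  have sub: "{tail_of e, head_of e} \<subseteq> {..<8}" "{tail_of f, head_of f} \<subseteq> {..<8}"
    using tail_head_less by auto
  note same = vertex_image_eqD(1)[OF sub eq] and poles = vertex_image_eqD(2)[OF sub eq]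
  show ?thesis
  proof (cases "j = j'")
    case True
    then have "e < f" using assms(1) k by linarith
    then have "two_sided (copy j ` path_image (tile_edge e) \<union> copy j ` path_image (tile_edge f))
        (place ` {..<2 + 6 * l})"
      using less(2) \<open>j' < l\<close> same unfolding True by (rule two_sided_parallel_in_copy)
    then show ?thesis unfolding path_image_curve True j_def[symmetric] e_def[symmetric]
        j'_def[symmetric] f_def[symmetric] .
  next
    case False
    have "tail_of e \<noteq> head_of e" using less(1) by (rule tail_neq_head)
    moreover have "tail_of e = 0 \<or> tail_of e = 7" "head_of e = 0 \<or> head_of e = 7"
      using False poles by simp_all
    ultimately have e: "{tail_of e, head_of e} = {0, 7}"
      by (elim disjE) (simp_all add: insert_commute)
    then have f: "{tail_of f, head_of f} = {0, 7}" by (simp only: same)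
    have "e = 7" "f = 7"
      using tile_pole_edge_check[unfolded list_all_upt, rule_format, OF conjI[OF le0 less(1)] e]
        tile_pole_edge_check[unfolded list_all_upt, rule_format, OF conjI[OF le0 less(2)] f] .
    moreover have "j < j'" using False assms(1) k less by linarith
    ultimately show ?thesis unfolding k using two_sided_pole_edges[OF _ \<open>j' < l\<close>] by simp
  qed
qed

text \<open>The two parts that form a lens share two points. These must be both ends of both edges, so the parts
are the entire edges, and these are parallel.\<close>

lemma non_homotopic_chain_graph:
  assumes "1 \<le> l"
  shows "non_homotopic (chain_graph l) place curve"
  unfolding non_homotopic_def
proof (intro ballI allI impI)
  fix k k' C R
  assume k: "k \<in> edges (chain_graph l)" "k' \<in> edges (chain_graph l)"
    and *: "k \<noteq> k' \<and> lens_boundary (curve k) (curve k') C \<and> R \<in> components (- C)"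
  from * have "lens_boundary (curve k) (curve k') C" by simp
  then obtain a b where ab: "arc a" "arc b" "path_image a \<subseteq> path_image (curve k)"
    "path_image b \<subseteq> path_image (curve k')" "pathstart a = pathstart b" "pathfinish a = pathfinish b"
    "path_image a \<inter> path_image b = {pathstart a, pathfinish a}" "C = path_image a \<union> path_image b"
    unfolding lens_boundary_def by (elim exE conjE) (rule that)
  let ?p = "pathstart a" and ?q = "pathfinish a"
  have "?p \<noteq> ?q" using arc_distinct_ends[OF ab(1)] by simp
  moreover have "{?p, ?q} \<subseteq> path_image (curve k) \<inter> path_image (curve k')"
    using ab(3,4,7) by blast
  moreover from this have "{?p, ?q} \<subseteq> path_image (curve k') \<inter> path_image (curve k)" by blast
  ultimately have ends: "{?p, ?q} = {pathstart (curve k), pathfinish (curve k)}"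
    "{?p, ?q} = {pathstart (curve k'), pathfinish (curve k')}"
    using common_pair_is_ends[of k k' ?p ?q] common_pair_is_ends[of k' k ?p ?q] * by metis+
  have C: "C = path_image (curve k) \<union> path_image (curve k')"
  proof -
    have "{pathstart (curve k), pathfinish (curve k)} \<subseteq> path_image a"
      unfolding ends(1)[symmetric] using ab(7) by blast
    with arc_curve ab(1,3) have "path_image a = path_image (curve k)" by (rule arc_subset_same_ends)
    moreover have "{pathstart (curve k'), pathfinish (curve k')} \<subseteq> path_image b"
      unfolding ends(2)[symmetric] using ab(7) by blast
    with arc_curve ab(2,4) have "path_image b = path_image (curve k')"
      by (rule arc_subset_same_ends)
    ultimately show ?thesis using ab(8) by simp
  qed
  have "place ` ends (chain_graph l) k = place ` ends (chain_graph l) k'"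
    unfolding ends_curve[symmetric] using ends by (rule trans[OF sym])
  moreover have "ends (chain_graph l) k \<subseteq> {..<2 + 6 * l}" "ends (chain_graph l) k' \<subseteq> {..<2 + 6 * l}"
    using wf_chain_graph[of l] k unfolding wf_multigraph_def chain_graph_simps(1) by blast+
  ultimately have par: "ends (chain_graph l) k = ends (chain_graph l) k'"
    using inj_on_image_eq_iff[OF inj_place[OF assms]] by blast
  have less: "k < 24 * l" "k' < 24 * l" using k by simp_all
  from * have "k < k' \<or> k' < k" by linarith
  then have "two_sided C (place ` {..<2 + 6 * l})"
  proof
    assume "k < k'"
    then show ?thesis unfolding C using less(2) par by (rule two_sided_parallel_curves)
  next
    assume "k' < k"
    then show ?thesis unfolding C Un_commute[of "path_image (curve k)"]
      using less(1) par[symmetric] by (rule two_sided_parallel_curves)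
  qed
  moreover from * have "R \<in> components (- C)" by simp
  ultimately have "R \<inter> place ` {..<2 + 6 * l} \<noteq> {}" by (rule two_sided_components)
  then show "R \<inter> (place ` verts (chain_graph l) \<union> crossings (chain_graph l) curve) \<noteq> {}"
    unfolding chain_graph_simps(1) by blast
qed

section \<open>The drawing for every number of tiles\<close>

theorem proposition4p4:
  fixes l n :: nat
  assumes "l \<ge> 1" and "n = 2 + 6 * l"
  shows "\<exists>(G :: (nat, nat) multigraph) (pos :: nat \<Rightarrow> complex) (\<gamma> :: nat \<Rightarrow> real \<Rightarrow> complex).
           wf_multigraph G \<and> card (verts G) = n \<and>
           is_drawing G pos \<gamma> \<and> non_homotopic G pos \<gamma> \<and> colorable_plane 2 1 G \<gamma> \<and>
           real (card (crossings G \<gamma>)) = 8 / 3 * (real n - 2) \<and>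
           real (card (edges G)) = 4 * (real n - 2)"
proof (intro exI conjI)
  show "wf_multigraph (chain_graph l)" by (rule wf_chain_graph)
  show "is_drawing (chain_graph l) place curve" "non_homotopic (chain_graph l) place curve"
    using assms(1) by (rule drawing_chain_graph, rule non_homotopic_chain_graph)
  show "colorable_plane 2 1 (chain_graph l) curve" by (rule colorable_chain_graph)
  show "card (verts (chain_graph l)) = n" using assms(2) by simp
  show "real (card (crossings (chain_graph l) curve)) = 8 / 3 * (real n - 2)"
    unfolding card_crossings_chain_graph using assms(2) by simp
  show "real (card (edges (chain_graph l))) = 4 * (real n - 2)" using assms(2) by simp
qed

end
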